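(* Let $k\ge2$ be a fixed integer, and for each $n$ let $p_1=p_1(n),\dots,p_k=p_k(n)$ be positive integers with $p_i/n\to y_i\in(0,1)$ as $n\to\infty$. Let $\mathbf{O}_1,\dots,\mathbf{O}_k$ be i.i.d. Haar distributed random orthogonal matrices on $O(n-1)$, let $\mathbf{P}_i=\mathbf{I}_{p_i}\oplus\mathbf{0}_{n-1-p_i}$, and let $\mathbf{Q}=\sum_{i=1}^k\mathbf{O}_i'\mathbf{P}_i\mathbf{O}_i$. Then for any sequence of deterministic polynomials $h_1,h_2,h_3,\dots$ (not depending on $n$), $$\operatorname{Cov}(\operatorname{tr}h_1(\mathbf{Q}),\operatorname{tr}h_2(\mathbf{Q}))=O(1)$$ and $$\lim_{n\to\infty}\kappa_r(\operatorname{tr}h_1(\mathbf{Q}),\dots,\operatorname{tr}h_r(\mathbf{Q}))=0\quad\text{for every } r\ge3,$$ where $\kappa_r(\xi_1,\dots,\xi_r)$ denotes the joint cumulant of the random variables $\xi_1,\dots,\xi_r$.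
   Context: $\mathbf{0}_m$ denotes the $m\times m$ zero matrix, so $\mathbf{P}_i$ is the $(n-1)\times(n-1)$ diagonal projection of rank $p_i$. *)

theory Defs
  imports "HOL-Probability.Probability" "HOL-Computational_Algebra.Polynomial"
    "HOL-Library.Landau_Symbols"
begin

text \<open>Real m x m matrices are modelled as extensional functions on
  {..<m} x {..<m}; the measurable space is the product of Borel sigma-algebras.\<close>

definition matM :: "nat \<Rightarrow> (nat \<times> nat \<Rightarrow> real) measure" where
  "matM m = PiM ({..<m} \<times> {..<m}) (\<lambda>_. borel)"

definition mk_mat :: "nat \<Rightarrow> (nat \<times> nat \<Rightarrow> real) \<Rightarrow> (nat \<times> nat \<Rightarrow> real)" where
  "mk_mat m f = restrict f ({..<m} \<times> {..<m})"

definition mmul :: "nat \<Rightarrow> (nat \<times> nat \<Rightarrow> real) \<Rightarrow> (nat \<times> nat \<Rightarrow> real) \<Rightarrow> (nat \<times> nat \<Rightarrow> real)" where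
  "mmul m A B = mk_mat m (\<lambda>(a,b). \<Sum>c<m. A (a,c) * B (c,b))"

definition mT :: "nat \<Rightarrow> (nat \<times> nat \<Rightarrow> real) \<Rightarrow> (nat \<times> nat \<Rightarrow> real)" where
  "mT m A = mk_mat m (\<lambda>(a,b). A (b,a))"

definition mid :: "nat \<Rightarrow> (nat \<times> nat \<Rightarrow> real)" where
  "mid m = mk_mat m (\<lambda>(a,b). if a = b then 1 else 0)"

definition mproj :: "nat \<Rightarrow> nat \<Rightarrow> (nat \<times> nat \<Rightarrow> real)" where
  "mproj m p = mk_mat m (\<lambda>(a,b). if a = b \<and> a < p then 1 else 0)"

definition msum :: "nat \<Rightarrow> 'i set \<Rightarrow> ('i \<Rightarrow> nat \<times> nat \<Rightarrow> real) \<Rightarrow> (nat \<times> nat \<Rightarrow> real)" where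
  "msum m I F = mk_mat m (\<lambda>ab. \<Sum>i\<in>I. F i ab)"

definition mpow :: "nat \<Rightarrow> (nat \<times> nat \<Rightarrow> real) \<Rightarrow> nat \<Rightarrow> (nat \<times> nat \<Rightarrow> real)" where
  "mpow m A j = (mmul m A ^^ j) (mid m)"

definition mpoly :: "nat \<Rightarrow> real poly \<Rightarrow> (nat \<times> nat \<Rightarrow> real) \<Rightarrow> (nat \<times> nat \<Rightarrow> real)" where
  "mpoly m h A = mk_mat m (\<lambda>ab. \<Sum>j\<le>degree h. coeff h j * mpow m A j ab)"

definition mtr :: "nat \<Rightarrow> (nat \<times> nat \<Rightarrow> real) \<Rightarrow> real" where
  "mtr m A = (\<Sum>a<m. A (a,a))"

definition orth_mats :: "nat \<Rightarrow> (nat \<times> nat \<Rightarrow> real) set" where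
  "orth_mats m = {A \<in> space (matM m). mmul m (mT m A) A = mid m}"

text \<open>Haar probability measure on O(m): a probability measure on the matrix space,
  concentrated on O(m), invariant under left multiplication by O(m).
  (Such a measure exists and is unique.)\<close>
definition haar_orth :: "nat \<Rightarrow> (nat \<times> nat \<Rightarrow> real) measure \<Rightarrow> bool" where
  "haar_orth m \<mu> \<longleftrightarrow> sets \<mu> = sets (matM m) \<and> prob_space \<mu> \<and>
     emeasure \<mu> (orth_mats m) = 1 \<and>
     (\<forall>U\<in>orth_mats m. distr \<mu> (matM m) (mmul m U) = \<mu>)"

definition Qmat :: "nat \<Rightarrow> nat \<Rightarrow> (nat \<Rightarrow> nat) \<Rightarrow> (nat \<Rightarrow> nat \<times> nat \<Rightarrow> real) \<Rightarrow> (nat \<times> nat \<Rightarrow> real)" where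
  "Qmat m k p Os = msum m {1..k} (\<lambda>i. mmul m (mmul m (mT m (Os i)) (mproj m (p i))) (Os i))"

definition covariance :: "'a measure \<Rightarrow> ('a \<Rightarrow> real) \<Rightarrow> ('a \<Rightarrow> real) \<Rightarrow> real" where
  "covariance M X Y = (\<integral>\<omega>. X \<omega> * Y \<omega> \<partial>M) - (\<integral>\<omega>. X \<omega> \<partial>M) * (\<integral>\<omega>. Y \<omega> \<partial>M)"

definition cumulant :: "'a measure \<Rightarrow> (nat \<Rightarrow> 'a \<Rightarrow> real) \<Rightarrow> nat \<Rightarrow> real" where
  "cumulant M \<xi> r = (\<Sum>P\<in>{P. partition_on {1..r} P}.
      (-1) ^ (card P - 1) * fact (card P - 1) *
      (\<Prod>B\<in>P. \<integral>\<omega>. (\<Prod>i\<in>B. \<xi> i \<omega>) \<partial>M))"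

end

theory Submission
  imports Defs
begin

text \<open>Put A_i = O_i' P_i O_i. The trace of h(Q) is a linear combination of traces of words in the A_i,
  so it suffices to show that a joint cumulant of r word traces has order m^(2 - r), m = n - 1.

  Invariance of the law of O_i under right multiplication by rotations of the (a,b) plane gives,
  to first order in the angle, that the derivative of the observable W_ab Tr W_2 ... Tr W_r along
  A_i -> [A_i, E_ab - E_ba] has mean zero. Summing over a and b yields an exact loop equation, which for a
  word W = i R expresses m Tr W through products of traces of two shorter words, single traces
  of reordered words, and traces of W merged with one of the other words. The total length of
  the words never increases. As Tr A_i is deterministic and A_i is idempotent, the equation passes to cumulants
  and closes by induction on the total length. For a fixed total length the polynomial a priori
  bound is improved by one power of m at a time, since splitting W raises the number of arguments.\<close>

subsection \<open>Convolution of set functions\<close>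

text \<open>Cumulants are treated as quotients. A set function f stands for the square-free series
  with coefficient f(S) at the product of the x_j with j in S, where x_j^2 = 0;
  \<open>subset_conv\<close> is the product of such series. Dividing the moment function of X and
  the T_j by that of the T_j alone gives the cumulants of X with the T_j, as in the derivative of
  log E exp. This is linear in X, and the divisor does not depend on X. Hence a linear relation
  between moment functions, valid on all index sets, can be divided as a whole, which is how the
  loop equation reaches cumulants. The obstacle to a plain induction on length: the cumulant of a
  product Tr U Tr V contains kappa(U, V, ...), with one more argument and the same total length. Its
  expected order is two powers of m below what the equation tolerates before the division by m, so
  an imperfect bound on it suffices; this drives the bootstrap. The remaining terms kappa(U; I)
  kappa(V; S - I) have shorter words and exactly the tolerated order.\<close>

definition subset_conv :: "('i set \<Rightarrow> real) \<Rightarrow> ('i set \<Rightarrow> real) \<Rightarrow> 'i set \<Rightarrow> real" where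
  "subset_conv f g S = (\<Sum>I\<in>Pow S. f I * g (S - I))"

text \<open>Division of \<open>F\<close> by \<open>M\<close>. With \<open>M {} = 1\<close> the
  convolution equation can be solved for its value at S once all proper subsets are known. The
  default 0 on infinite sets keeps the recursion on the cardinality well-founded.\<close>

function deconv :: "('i set \<Rightarrow> real) \<Rightarrow> ('i set \<Rightarrow> real) \<Rightarrow> 'i set \<Rightarrow> real" where
  "deconv M F S = (if finite S then F S - (\<Sum>I\<in>{I. I \<subset> S}. deconv M F I * M (S - I)) else 0)"
  by pat_completeness auto
termination
  by (relation "Wellfounded.measure (\<lambda>(M,F,S). card S)") (auto simp: psubset_card_mono)

declare deconv.simps [simp del]

lemma Pow_psubset: "Pow S = insert S {I. I \<subset> S}"
  by auto

lemma subset_conv_psubset: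
  assumes "finite S" "g {} = 1"
  shows "subset_conv f g S = f S + (\<Sum>I\<in>{I. I \<subset> S}. f I * g (S - I))"
proof -
  have "finite {I. I \<subset> S}"
    by (rule finite_subset[of _ "Pow S"]) (use assms(1) in auto)
  then show ?thesis
    unfolding subset_conv_def Pow_psubset using assms(2) by (subst sum.insert) auto
qed

lemma subset_conv_deconv:
  assumes "finite S" "M {} = 1"
  shows "subset_conv (deconv M F) M S = F S"
  using assms by (simp add: subset_conv_psubset deconv.simps[of M F S])

lemma deconv_unique:
  assumes "finite S" "M {} = 1" "\<And>I. I \<subseteq> S \<Longrightarrow> subset_conv f M I = F I"
  shows "f S = deconv M F S"
  using assms(1,3)
proof (induction S rule: finite_psubset_induct)
  case (psubset S)
  have eq: "f I = deconv M F I" if "I \<subset> S" for I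
    using psubset.IH[OF that] psubset.prems that by auto
  have "f S = F S - (\<Sum>I\<in>{I. I \<subset> S}. f I * M (S - I))"
    using psubset.prems[of S] psubset.hyps assms(2) by (simp add: subset_conv_psubset)
  also have "\<dots> = deconv M F S"
    using eq psubset.hyps by (simp add: deconv.simps[of M F S])
  finally show ?case .
qed

lemma deconv_cong:
  assumes "\<And>I. I \<subseteq> S \<Longrightarrow> M I = M' I" "\<And>I. I \<subseteq> S \<Longrightarrow> F I = F' I"
  shows "deconv M F S = deconv M' F' S"
proof (cases "finite S")
  case True
  then show ?thesis using assms
  proof (induction S rule: finite_psubset_induct)
    case (psubset S)
    have "deconv M F I = deconv M' F' I" if "I \<subset> S" for I
      using psubset.IH[OF that] psubset.prems that by auto
    moreover have "M (S - I) = M' (S - I)" for I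
      using psubset.prems by auto
    ultimately show ?case
      using psubset.prems(2)[of S] by (simp add: deconv.simps[of _ _ S])
  qed
qed (simp add: deconv.simps)

text \<open>Linearity in the numerator, by a pattern that recurs below: propose the quotient, check
  the convolution equation, and conclude by \<open>deconv_unique\<close>.\<close>

lemma deconv_sum:
  assumes "M {} = 1" "finite S"
    and "\<And>I. I \<subseteq> S \<Longrightarrow> F I = (\<Sum>x\<in>A. c x * G x I)"
  shows "deconv M F S = (\<Sum>x\<in>A. c x * deconv M (G x) S)"
proof (rule deconv_unique[symmetric])
  fix I assume I: "I \<subseteq> S"
  have "subset_conv (\<lambda>I. \<Sum>x\<in>A. c x * deconv M (G x) I) M I = (\<Sum>x\<in>A. c x * subset_conv (deconv M (G x)) M I)"
    unfolding subset_conv_def sum_distrib_left sum_distrib_right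
    by (subst sum.swap) (simp add: mult_ac)
  also have "\<dots> = F I"
    using I assms finite_subset[OF I] by (simp add: subset_conv_deconv)
  finally show "subset_conv (\<lambda>I. \<Sum>x\<in>A. c x * deconv M (G x) I) M I = F I" .
qed (use assms in auto)

lemma deconv_add:
  assumes "M {} = 1" "finite S"
  shows "deconv M (\<lambda>I. F I + G I) S = deconv M F S + deconv M G S"
  using deconv_sum[where M = M and F = "\<lambda>I. F I + G I" and A = "{True,False}" and c = "\<lambda>_. 1"
      and G = "\<lambda>b. if b then F else G", OF assms]
  by simp

lemma deconv_scale:
  assumes "M {} = 1" "finite S"
  shows "deconv M (\<lambda>I. c * F I) S = c * deconv M F S"
  using deconv_sum[where M = M and F = "\<lambda>I. c * F I" and A = "{()}" and c = "\<lambda>_. c" and G = "\<lambda>_. F", OF assms] by simp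

lemma deconv_diff:
  assumes "M {} = 1" "finite S"
  shows "deconv M (\<lambda>I. F I - G I) S = deconv M F S - deconv M G S"
  using deconv_add[where M = M and F = F and G = "\<lambda>I. (-1) * G I", OF assms]
    deconv_scale[where M = M and c = "-1" and F = G, OF assms] by simp

lemma deconv_sum1:
  assumes "M {} = 1" "finite S"
  shows "deconv M (\<lambda>I. \<Sum>x\<in>A. G x I) S = (\<Sum>x\<in>A. deconv M (G x) S)"
  using deconv_sum[where M = M and F = "\<lambda>I. \<Sum>x\<in>A. G x I" and A = A and c = "\<lambda>_. 1" and G = G, OF assms] by simp

text \<open>The quotient c M / M is the constant series c, which lives on the empty set only. For
  cumulants: a constant has no joint cumulant with other variables.\<close>

lemma deconv_const:
  assumes "M {} = 1" "finite S"
  shows "deconv M (\<lambda>I. c * M I) S = (if S = {} then c else 0)"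
proof (rule deconv_unique[symmetric])
  fix I assume "I \<subseteq> S"
  then have "finite I" using assms(2) finite_subset by auto
  then show "subset_conv (\<lambda>S. if S = {} then c else 0) M I = c * M I"
    unfolding subset_conv_def by (subst sum.remove[of _ "{}"]) auto
qed (use assms in auto)

lemma sum_Pow_insert:
  fixes f :: "'i set \<Rightarrow> real"
  assumes "finite S" "y \<notin> S"
  shows "sum f (Pow (insert y S)) = (\<Sum>I\<in>Pow S. f (insert y I)) + sum f (Pow S)"
proof -
  have "Pow (insert y S) = Pow S \<union> insert y ` Pow S" by (rule Pow_insert)
  moreover have "Pow S \<inter> insert y ` Pow S = {}" using assms by auto
  moreover have "inj_on (insert y) (Pow S)"
    using assms(2) by (auto simp: inj_on_def)
  ultimately show ?thesis
    using assms(1) by (simp add: sum.union_disjoint sum.reindex)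
qed

text \<open>Removing the index j is multiplication by the variable x_j, which commutes with division
  by \<open>M\<close>. It serves the merge terms of the loop equation, where one trace has left the
  product.\<close>

lemma deconv_shift:
  assumes "M {} = 1" "finite S" "j \<in> S"
  shows "deconv M (\<lambda>I. if j \<in> I then F (I - {j}) else 0) S = deconv M F (S - {j})"
proof -
  have "(\<lambda>S. if j \<in> S then deconv M F (S - {j}) else 0) S =
        deconv M (\<lambda>I. if j \<in> I then F (I - {j}) else 0) S"
  proof (rule deconv_unique)
    fix I assume I: "I \<subseteq> S"
    have fin: "finite I" using I assms finite_subset by blast
    show "subset_conv (\<lambda>S. if j \<in> S then deconv M F (S - {j}) else 0) M I
        = (if j \<in> I then F (I - {j}) else 0)"
    proof (cases "j \<in> I")
      case True
      define S0 where "S0 = I - {j}"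
      have S0: "I = insert j S0" "j \<notin> S0" "finite S0"
        using True fin by (auto simp: S0_def)
      have j: "j \<notin> J" "insert j J - {j} = J" "insert j S0 - insert j J = S0 - J"
        if "J \<in> Pow S0" for J
        using S0(2) that by auto
      have "subset_conv (\<lambda>S. if j \<in> S then deconv M F (S - {j}) else 0) M I
        = (\<Sum>J\<in>Pow S0. deconv M F J * M (S0 - J)) + (\<Sum>J\<in>Pow S0. 0)"
        unfolding subset_conv_def S0(1) sum_Pow_insert[OF S0(3,2)]
        by (intro arg_cong2[where f = "(+)"] sum.cong refl) (use j in auto)
      then show ?thesis using True S0 subset_conv_deconv[where M = M and F = F, OF S0(3) assms(1)]
        by (simp add: subset_conv_def)
    next
      case False
      then show ?thesis by (auto simp: subset_conv_def intro!: sum.neutral)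
    qed
  qed (use assms in auto)
  then show ?thesis using assms by simp
qed

text \<open>Both sides sum over the ordered splittings of S into three parts.\<close>

lemma subset_conv_assoc:
  assumes "finite S"
  shows "subset_conv (subset_conv f g) h S = subset_conv f (subset_conv g h) S"
proof -
  have "subset_conv (subset_conv f g) h S = (\<Sum>(I,J)\<in>(SIGMA I:Pow S. Pow I). f J * g (I - J) * h (S - I))"
    unfolding subset_conv_def sum_distrib_right
    using assms by (subst sum.Sigma) (auto intro: finite_subset)
  also have "\<dots> = (\<Sum>(J,L)\<in>(SIGMA J:Pow S. Pow (S - J)). f J * g L * h (S - J - L))"
    by (rule sum.reindex_bij_witness[of _ "\<lambda>(J,L). (J \<union> L, J)" "\<lambda>(I,J). (J, I - J)"])
       (auto intro!: arg_cong[where f = h] arg_cong[where f = g])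
  also have "\<dots> = subset_conv f (subset_conv g h) S"
    unfolding subset_conv_def sum_distrib_left
    using assms by (subst sum.Sigma) (auto simp: mult.assoc)
  finally show ?thesis .
qed

text \<open>Here F is the moment function of X, G that of Y, and P that of the product X Y,
  the variable Y being also the one with index y.\<close>
lemma deconv_insert:
  assumes M: "M {} = 1" and S: "finite S" "y \<notin> S"
    and G: "\<And>I. I \<subseteq> S \<Longrightarrow> M (insert y I) = G I"
    and P: "\<And>I. I \<subseteq> S \<Longrightarrow> F (insert y I) = P I"
  shows "deconv M F (insert y S) = deconv M P S - subset_conv (deconv M F) (deconv M G) S"
proof -
  have "(\<lambda>S. deconv M F (insert y S) + subset_conv (deconv M F) (deconv M G) S) S = deconv M P S"
  proof (rule deconv_unique[where f = "\<lambda>S. deconv M F (insert y S) + subset_conv (deconv M F) (deconv M G) S"])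
    fix I assume I: "I \<subseteq> S"
    have fin: "finite I" and y: "y \<notin> I" using I S finite_subset by auto
    have 1: "subset_conv (subset_conv (deconv M F) (deconv M G)) M I = (\<Sum>J\<in>Pow I. deconv M F J * M (insert y I - J))"
      unfolding subset_conv_assoc[OF fin]
      unfolding subset_conv_def[of "deconv M F"]
    proof (rule sum.cong)
      fix J assume J: "J \<in> Pow I"
      then have "subset_conv (deconv M G) M (I - J) = G (I - J)"
        using fin by (intro subset_conv_deconv M) auto
      also have "\<dots> = M (insert y (I - J))" using I by (intro G[symmetric]) auto
      also have "insert y (I - J) = insert y I - J" using J y by auto
      finally show "deconv M F J * subset_conv (deconv M G) M (I - J) = deconv M F J * M (insert y I - J)" by simp
    qed simp
    have 2: "P I = subset_conv (deconv M F) M (insert y I)"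
      using P[OF I] subset_conv_deconv[of "insert y I" M F] fin M by simp
    have 3: "subset_conv (\<lambda>S. deconv M F (insert y S)) M I = (\<Sum>J\<in>Pow I. deconv M F (insert y J) * M (insert y I - insert y J))"
      unfolding subset_conv_def using y by (auto intro!: sum.cong arg_cong[where f = M])
    \<comment> \<open>A splitting of \<open>insert y I\<close> puts y either into the first factor,
      which is \<open>3\<close>, or into the second, which is \<open>1\<close>.\<close>
    have "subset_conv (\<lambda>S. deconv M F (insert y S) + subset_conv (deconv M F) (deconv M G) S) M I =
        subset_conv (\<lambda>S. deconv M F (insert y S)) M I + subset_conv (subset_conv (deconv M F) (deconv M G)) M I"
      by (simp add: subset_conv_def[of _ M] algebra_simps sum.distrib)
    also have "\<dots> = P I"
      unfolding 1 2 3 unfolding subset_conv_def sum_Pow_insert[OF fin y] ..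
    finally show "subset_conv (\<lambda>S. deconv M F (insert y S) + subset_conv (deconv M F) (deconv M G) S) M I = P I" .
  qed (use assms in auto)
  then show ?thesis by simp
qed

subsection \<open>Words in symmetric matrices\<close>

text \<open>Entry of the product of the matrices \<open>A l\<close> along the word. Matrices are
  plain binary functions here and the empty word is the identity on all indices, so range conditions
  appear only where a sum has to hit its index.\<close>

definition word_entry :: "nat \<Rightarrow> (nat \<Rightarrow> nat \<Rightarrow> nat \<Rightarrow> real) \<Rightarrow> nat list \<Rightarrow> nat \<Rightarrow> nat \<Rightarrow> real" where
  "word_entry m A w = foldr (\<lambda>l B a b. \<Sum>c<m. A l a c * B c b) w (\<lambda>a b. of_bool (a = b))"

definition word_trace :: "nat \<Rightarrow> (nat \<Rightarrow> nat \<Rightarrow> nat \<Rightarrow> real) \<Rightarrow> nat list \<Rightarrow> real" where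
  "word_trace m A w = (\<Sum>a<m. word_entry m A w a a)"

lemma word_entry_Nil [simp]: "word_entry m A [] a b = of_bool (a = b)"
  by (simp add: word_entry_def)

lemma word_entry_Cons: "word_entry m A (l # w) a b = (\<Sum>c<m. A l a c * word_entry m A w c b)"
  by (simp add: word_entry_def)

lemma sum_of_bool_left: "a < m \<Longrightarrow> (\<Sum>c<m. of_bool (a = c) * f c) = (f a :: real)"
  and sum_of_bool_left': "a < m \<Longrightarrow> (\<Sum>c<m. of_bool (c = a) * f c) = (f a :: real)"
  and sum_of_bool_right: "a < m \<Longrightarrow> (\<Sum>c<m. f c * of_bool (a = c)) = (f a :: real)"
  and sum_of_bool_right': "a < m \<Longrightarrow> (\<Sum>c<m. f c * of_bool (c = a)) = (f a :: real)"
  for m a :: nat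
  by (simp_all add: of_bool_def if_distrib[of "\<lambda>x. x * _"] if_distrib[of "\<lambda>x. _ * x"] sum.delta sum.delta' cong: if_cong)

lemmas sum_of_bool = sum_of_bool_left sum_of_bool_left' sum_of_bool_right sum_of_bool_right'

lemma word_entry_single: "b < m \<Longrightarrow> word_entry m A [l] a b = A l a b"
  by (simp add: word_entry_Cons sum_of_bool del: of_bool_eq_iff)

lemma word_entry_append:
  "a < m \<Longrightarrow> word_entry m A (u @ v) a b = (\<Sum>c<m. word_entry m A u a c * word_entry m A v c b)"
proof (induction u arbitrary: a)
  case (Cons l u)
  have "word_entry m A ((l # u) @ v) a b = (\<Sum>d<m. A l a d * (\<Sum>c<m. word_entry m A u d c * word_entry m A v c b))"
    using Cons.IH by (simp add: word_entry_Cons)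
  also have "\<dots> = (\<Sum>c<m. word_entry m A (l # u) a c * word_entry m A v c b)"
    unfolding word_entry_Cons sum_distrib_left sum_distrib_right by (subst sum.swap) (simp add: mult_ac)
  finally show ?case .
qed (simp add: sum_of_bool)

lemma word_entry_rev:
  assumes sym: "\<And>l a b. A l a b = A l b a"
  shows "a < m \<Longrightarrow> b < m \<Longrightarrow> word_entry m A (rev w) a b = word_entry m A w b a"
proof (induction w arbitrary: a b)
  case (Cons l w)
  have "word_entry m A (rev (l # w)) a b = (\<Sum>c<m. word_entry m A (rev w) a c * A l c b)"
    using Cons.prems by (simp add: word_entry_append word_entry_single)
  also have "\<dots> = (\<Sum>c<m. A l b c * word_entry m A w c a)"
    using Cons.IH[OF Cons.prems(1)] by (intro sum.cong) (auto simp: sym[of l _ b] mult.commute)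
  finally show ?case by (simp add: word_entry_Cons)
qed auto

lemma word_trace_append: "word_trace m A (u @ v) = (\<Sum>a<m. \<Sum>b<m. word_entry m A u a b * word_entry m A v b a)"
  by (simp add: word_trace_def word_entry_append)

lemma word_trace_commute: "word_trace m A (u @ v) = word_trace m A (v @ u)"
  unfolding word_trace_append by (subst sum.swap) (simp add: mult.commute)

text \<open>For symmetric letters the transpose of a word is its reversal, so pairing entries in
  equal positions yields a trace. This is the origin of the reversed words in the loop
  equation.\<close>

lemma word_trace_append_rev:
  assumes sym: "\<And>l a b. A l a b = A l b a"
  shows "word_trace m A (u @ rev v) = (\<Sum>a<m. \<Sum>b<m. word_entry m A u a b * word_entry m A v a b)"
  by (simp add: word_trace_append word_entry_rev[of A, OF sym])

lemma word_trace_Nil [simp]: "word_trace m A [] = real m"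
  by (simp add: word_trace_def)

lemma word_entry_idem:
  assumes idem: "\<And>a b. (\<Sum>c<m. A l a c * A l c b) = A l a b"
  shows "word_entry m A (l # l # w) a b = word_entry m A (l # w) a b"
proof -
  have "word_entry m A (l # l # w) a b = (\<Sum>d<m. (\<Sum>c<m. A l a c * A l c d) * word_entry m A w d b)"
    unfolding word_entry_Cons sum_distrib_left sum_distrib_right by (subst sum.swap) (simp add: mult_ac)
  then show ?thesis by (simp add: idem word_entry_Cons)
qed

text \<open>Cyclicity brings the last letter next to the equal first one, where idempotence absorbs
  it.\<close>

lemma word_trace_butlast:
  assumes idem: "\<And>a b. (\<Sum>c<m. A l a c * A l c b) = A l a b"
  shows "word_trace m A (l # u @ [l]) = word_trace m A (l # u)"
proof -
  have "word_trace m A (l # u @ [l]) = word_trace m A ([l] @ l # u)"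
    using word_trace_commute[of m A "l # u" "[l]"] by simp
  also have "\<dots> = word_trace m A (l # u)"
    by (simp add: word_trace_def word_entry_idem[where A = A, OF idem])
  finally show ?thesis .
qed

text \<open>A crude bound: every letter costs one factor m for its entry and one for the summation.
  It only serves to start the bootstrap, which needs no more than polynomial growth.\<close>

lemma word_entry_bound:
  assumes "\<And>l a b. a < m \<Longrightarrow> b < m \<Longrightarrow> \<bar>A l a b\<bar> \<le> real m"
  shows "a < m \<Longrightarrow> b < m \<Longrightarrow> \<bar>word_entry m A w a b\<bar> \<le> real m ^ (2 * length w)"
proof (induction w arbitrary: a)
  case (Cons l w)
  have "\<bar>word_entry m A (l # w) a b\<bar> \<le> (\<Sum>c<m. \<bar>A l a c\<bar> * \<bar>word_entry m A w c b\<bar>)"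
    unfolding word_entry_Cons by (rule order_trans[OF sum_abs]) (simp add: abs_mult)
  also have "\<dots> \<le> (\<Sum>c<m. real m * real m ^ (2 * length w))"
    using Cons.prems by (intro sum_mono mult_mono Cons.IH assms) auto
  also have "\<dots> = real m ^ (2 * length (l # w))" by simp
  finally show ?case .
qed auto

lemma word_trace_bound:
  assumes "\<And>l a b. a < m \<Longrightarrow> b < m \<Longrightarrow> \<bar>A l a b\<bar> \<le> real m"
  shows "\<bar>word_trace m A w\<bar> \<le> real m ^ (2 * length w + 1)"
proof -
  have "\<bar>word_trace m A w\<bar> \<le> (\<Sum>a<m. real m ^ (2 * length w))"
    unfolding word_trace_def by (intro order_trans[OF sum_abs] sum_mono word_entry_bound assms) auto
  then show ?thesis by simp
qed

text \<open>The (c,d) entry of the derivative of the word w when the matrix A i is moved along the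
  commutator [A i, X], where X = E_ab - E_ba.\<close>
definition word_deriv :: "nat \<Rightarrow> (nat \<Rightarrow> nat \<Rightarrow> nat \<Rightarrow> real) \<Rightarrow> nat \<Rightarrow> nat \<Rightarrow> nat \<Rightarrow> nat list \<Rightarrow> nat \<Rightarrow> nat \<Rightarrow> real" where
  "word_deriv m A i a b w c d = (\<Sum>t | t < length w \<and> w ! t = i.
     word_entry m A (take (Suc t) w) c a * word_entry m A (drop (Suc t) w) b d
   - word_entry m A (take (Suc t) w) c b * word_entry m A (drop (Suc t) w) a d
   - word_entry m A (take t w) c a * word_entry m A (drop t w) b d
   + word_entry m A (take t w) c b * word_entry m A (drop t w) a d)"

text \<open>The (c,d) entry of A_i X - X A_i for X = E_ab - E_ba, with the unit matrices written as
  Kronecker deltas.\<close>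

definition comm_entry :: "(nat \<Rightarrow> nat \<Rightarrow> nat \<Rightarrow> real) \<Rightarrow> nat \<Rightarrow> nat \<Rightarrow> nat \<Rightarrow> nat \<Rightarrow> nat \<Rightarrow> real" where
  "comm_entry A i a b c d = A i c a * of_bool (b = d) - A i c b * of_bool (a = d)
     - of_bool (c = a) * A i b d + of_bool (c = b) * A i a d"

lemma word_deriv_Nil [simp]: "word_deriv m A i a b [] c d = 0"
  by (simp add: word_deriv_def)

text \<open>Leibniz rule: the commutator hits the first letter or the rest of the word. It matches
  the recursion \<open>word_entry_Cons\<close>, so the formula by positions can be verified by
  induction on the word.\<close>

lemma word_deriv_Cons:
  assumes "a < m" "b < m"
  shows "word_deriv m A i a b (l # w) c d =
    of_bool (l = i) * (\<Sum>e<m. comm_entry A i a b c e * word_entry m A w e d) + (\<Sum>e<m. A l c e * word_deriv m A i a b w e d)"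
proof -
  have set: "{t. t < length (l # w) \<and> (l # w) ! t = i} =
     (if l = i then {0} else {}) \<union> Suc ` {t. t < length w \<and> w ! t = i}"
    by (auto simp: less_Suc_eq_0_disj)
  have fin: "finite {t. t < length w \<and> w ! t = i}" by simp
  let ?D = "\<lambda>w t c. word_entry m A (take (Suc t) w) c a * word_entry m A (drop (Suc t) w) b d
   - word_entry m A (take (Suc t) w) c b * word_entry m A (drop (Suc t) w) a d
   - word_entry m A (take t w) c a * word_entry m A (drop t w) b d
   + word_entry m A (take t w) c b * word_entry m A (drop t w) a d"
  have "word_deriv m A i a b (l # w) c d = of_bool (l = i) * ?D (l # w) 0 c
      + (\<Sum>t | t < length w \<and> w ! t = i. ?D (l # w) (Suc t) c)"
    unfolding word_deriv_def set by (subst sum.union_disjoint) (auto simp: sum.reindex)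
  moreover have "?D (l # w) (Suc t) c = (\<Sum>e<m. A l c e * ?D w t e)" for t
    unfolding take_Suc_Cons drop_Suc_Cons word_entry_Cons[of m A l "take _ w"]
    by (simp add: sum_distrib_left sum_distrib_right algebra_simps sum.distrib sum_subtractf)
  moreover have "(\<Sum>t | t < length w \<and> w ! t = i. \<Sum>e<m. A l c e * ?D w t e) = (\<Sum>e<m. A l c e * word_deriv m A i a b w e d)"
    unfolding word_deriv_def sum_distrib_left by (rule sum.swap)
  \<comment> \<open>At position 0 the two prefixes are \<open>[i]\<close> and \<open>[]\<close>, and
    the four products become the four terms of the commutator.\<close>
  moreover have "?D (l # w) 0 c = (\<Sum>e<m. comm_entry A i a b c e * word_entry m A w e d)" if "l = i"
  proof -
    have "(\<Sum>e<m. comm_entry A i a b c e * word_entry m A w e d) =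
       A i c a * (\<Sum>e<m. of_bool (b = e) * word_entry m A w e d) - A i c b * (\<Sum>e<m. of_bool (a = e) * word_entry m A w e d)
      - of_bool (c = a) * word_entry m A (i # w) b d + of_bool (c = b) * word_entry m A (i # w) a d"
      unfolding comm_entry_def word_entry_Cons sum_distrib_left
      by (simp only: sum_subtractf[symmetric] sum.distrib[symmetric])
         (intro sum.cong refl, simp only: algebra_simps)
    then show ?thesis
      using assms that by (simp only: sum_of_bool take_Suc_Cons take_0 drop_Suc_Cons drop_0 word_entry_Nil word_entry_single)
  qed
  ultimately show ?thesis by simp
qed

lemma word_deriv_same: "word_deriv m A i a a w c d = 0"
  by (simp add: word_deriv_def)

text \<open>The entry (a,b) lies in the plane of the rotation, so the double sum collapses: entries
  (a,a) and (b,b) decouple into a product of two traces, and two entries (a,b) join into one trace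
  with a reversed part. The products are the splitting terms.\<close>

lemma sum_word_deriv_diag:
  assumes sym: "\<And>l a b. A l a b = A l b a"
  shows "(\<Sum>a<m. \<Sum>b<m. word_deriv m A i a b v a b) = (\<Sum>t | t < length v \<and> v ! t = i.
      word_trace m A (take (Suc t) v) * word_trace m A (drop (Suc t) v)
    - word_trace m A (take (Suc t) v @ rev (drop (Suc t) v))
    - word_trace m A (take t v) * word_trace m A (drop t v)
    + word_trace m A (take t v @ rev (drop t v)))"
proof -
  have 1: "(\<Sum>a<m. \<Sum>b<m. word_entry m A u a a * word_entry m A w b b) = word_trace m A u * word_trace m A w" for u w
    by (simp add: word_trace_def sum_product)
  have 2: "(\<Sum>a<m. \<Sum>b<m. word_entry m A u a b * word_entry m A w a b) = word_trace m A (u @ rev w)" for u w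
    by (simp add: word_trace_append_rev[of A, OF sym])
  have "(\<Sum>a<m. \<Sum>b<m. word_deriv m A i a b v a b) = (\<Sum>t | t < length v \<and> v ! t = i. \<Sum>a<m. \<Sum>b<m.
     word_entry m A (take (Suc t) v) a a * word_entry m A (drop (Suc t) v) b b
   - word_entry m A (take (Suc t) v) a b * word_entry m A (drop (Suc t) v) a b
   - word_entry m A (take t v) a a * word_entry m A (drop t v) b b
   + word_entry m A (take t v) a b * word_entry m A (drop t v) a b)"
    unfolding word_deriv_def by (subst (2) sum.swap, subst (1) sum.swap) rule
  then show ?thesis
    by (simp only: sum.distrib sum_subtractf 1 2)
qed

text \<open>Differentiating a trace cuts its cyclic word open at an occurrence of i, and contraction
  with the (a,b) entry of v inserts the opened word, forwards or reversed, behind v. These are the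
  merge terms.\<close>

lemma sum_word_deriv_trace:
  assumes sym: "\<And>l a b. A l a b = A l b a"
  shows "(\<Sum>a<m. \<Sum>b<m. word_entry m A v a b * (\<Sum>c<m. word_deriv m A i a b w c c)) =
    (\<Sum>t | t < length w \<and> w ! t = i.
      word_trace m A (v @ drop (Suc t) w @ take (Suc t) w)
    - word_trace m A (v @ rev (drop (Suc t) w @ take (Suc t) w))
    - word_trace m A (v @ drop t w @ take t w)
    + word_trace m A (v @ rev (drop t w @ take t w)))"
proof -
  have c: "(\<Sum>c<m. word_entry m A u c a * word_entry m A x b c) = word_entry m A (x @ u) b a" if "b < m" for u x a b
    using that by (simp add: word_entry_append mult.commute)
  have tr: "(\<Sum>c<m. word_deriv m A i a b w c c) = (\<Sum>t | t < length w \<and> w ! t = i.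
      word_entry m A (drop (Suc t) w @ take (Suc t) w) b a - word_entry m A (drop (Suc t) w @ take (Suc t) w) a b
     - word_entry m A (drop t w @ take t w) b a + word_entry m A (drop t w @ take t w) a b)"
    if "a < m" "b < m" for a b
    unfolding word_deriv_def using that
    by (subst sum.swap) (simp add: sum.distrib sum_subtractf c)
  have 1: "(\<Sum>a<m. \<Sum>b<m. word_entry m A v a b * word_entry m A x b a) = word_trace m A (v @ x)" for x
    by (simp add: word_trace_append)
  have 2: "(\<Sum>a<m. \<Sum>b<m. word_entry m A v a b * word_entry m A x a b) = word_trace m A (v @ rev x)" for x
    by (simp add: word_trace_append_rev[of A, OF sym])
  have "(\<Sum>a<m. \<Sum>b<m. word_entry m A v a b * (\<Sum>c<m. word_deriv m A i a b w c c)) =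
     (\<Sum>a<m. \<Sum>b<m. \<Sum>t | t < length w \<and> w ! t = i. word_entry m A v a b * (
      word_entry m A (drop (Suc t) w @ take (Suc t) w) b a - word_entry m A (drop (Suc t) w @ take (Suc t) w) a b
     - word_entry m A (drop t w @ take t w) b a + word_entry m A (drop t w @ take t w) a b))"
    by (simp add: tr sum_distrib_left)
  also have "\<dots> = (\<Sum>t | t < length w \<and> w ! t = i. \<Sum>a<m. \<Sum>b<m. word_entry m A v a b * (
      word_entry m A (drop (Suc t) w @ take (Suc t) w) b a - word_entry m A (drop (Suc t) w @ take (Suc t) w) a b
     - word_entry m A (drop t w @ take t w) b a + word_entry m A (drop t w @ take t w) a b))"
    by (subst (2) sum.swap, subst (1) sum.swap) rule
  also have "\<dots> = (\<Sum>t | t < length w \<and> w ! t = i.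
      word_trace m A (v @ drop (Suc t) w @ take (Suc t) w)
    - word_trace m A (v @ rev (drop (Suc t) w @ take (Suc t) w))
    - word_trace m A (v @ drop t w @ take t w)
    + word_trace m A (v @ rev (drop t w @ take t w)))"
    unfolding 2[symmetric] unfolding 1[symmetric]
    by (simp add: algebra_simps sum.distrib sum_subtractf del: rev_append)
  finally show ?thesis .
qed

subsection \<open>Joint cumulants\<close>

definition partition_cumulant :: "('i set \<Rightarrow> real) \<Rightarrow> 'i set \<Rightarrow> real" where
  "partition_cumulant M S = (\<Sum>P\<in>{P. partition_on S P}. (-1) ^ (card P - 1) * fact (card P - 1) * (\<Prod>B\<in>P. M B))"

lemma finite_partitions: "finite S \<Longrightarrow> finite {P. partition_on S P}"
  by (rule finite_subset[of _ "Pow (Pow S)"]) (auto simp: partition_on_def)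

text \<open>Summing over I and over the partitions of insert x I amounts to summing over the partitions
  of insert x S, where the complement of I contributes either nothing or a marked block avoiding x.
  The q - 1 ways to mark a block of a partition with q blocks make the weights cancel unless q = 1.\<close>
lemma subset_conv_partition_cumulant:
  assumes S: "finite S" "x \<notin> S" and M: "M {} = 1"
  shows "subset_conv (\<lambda>I. partition_cumulant M (insert x I)) M S = M (insert x S)"
proof -
  define wgt :: "nat \<Rightarrow> real" where "wgt q = (-1) ^ (q - 1) * fact (q - 1)" for q
  let ?S = "insert x S"
  let ?Q = "{P. partition_on ?S P}"
  have finQ: "finite ?Q" using S by (intro finite_partitions) auto
  have finP: "finite P" if "partition_on ?S P" for P
    using that S by (auto intro: finite_elements)
  have fS: "finite {I. I \<subset> S}"
    by (rule finite_subset[of _ "Pow S"]) (use S in auto)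
  have subset_conv: "subset_conv (\<lambda>I. partition_cumulant M (insert x I)) M S =
     partition_cumulant M ?S + (\<Sum>I\<in>{I. I \<subset> S}. partition_cumulant M (insert x I) * M (S - I))"
    by (rule subset_conv_psubset) (use S M in auto)
  have "(\<Sum>I\<in>{I. I \<subset> S}. partition_cumulant M (insert x I) * M (S - I)) =
     (\<Sum>(I,P)\<in>(SIGMA I:{I. I \<subset> S}. {P. partition_on (insert x I) P}). wgt (card P) * (\<Prod>B\<in>P. M B) * M (S - I))"
    unfolding partition_cumulant_def wgt_def sum_distrib_right
    using fS S by (subst sum.Sigma) (auto intro!: finite_partitions intro: finite_subset)
  also have "\<dots> = (\<Sum>(P,B)\<in>(SIGMA P:?Q. {B\<in>P. x \<notin> B}). wgt (card P - 1) * (\<Prod>B\<in>P. M B))"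
  proof (rule sum.reindex_bij_witness[of _ "\<lambda>(P,B). (S - B, P - {B})" "\<lambda>(I,P). (insert (S - I) P, S - I)"])
    fix u assume "u \<in> (SIGMA I:{I. I \<subset> S}. {P. partition_on (insert x I) P})"
    then obtain I P where u: "u = (I, P)" and I: "I \<subset> S" and P: "partition_on (insert x I) P" by auto
    have nin: "S - I \<notin> P"
      using I P S(2) by (auto simp: partition_on_def)
    then show "(case case u of (I, P) \<Rightarrow> (insert (S - I) P, S - I) of (P, B) \<Rightarrow> (S - B, P - {B})) = u"
      using u I by auto
    have "disjnt (S - I) (\<Union>P)" "?S - (S - I) = insert x I"
      using P I S(2) by (auto simp: disjnt_def partition_on_def)
    then have part: "partition_on ?S (insert (S - I) P)"
      using P I by (subst partition_on_insert) auto
    then show "(case u of (I, P) \<Rightarrow> (insert (S - I) P, S - I)) \<in> (SIGMA P:?Q. {B \<in> P. x \<notin> B})"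
      using u S by auto
    have fin: "finite P" using finP[OF part] by simp
    show "(case case u of (I, P) \<Rightarrow> (insert (S - I) P, S - I) of (P, B) \<Rightarrow> wgt (card P - 1) * prod M P) =
         (case u of (I, P) \<Rightarrow> wgt (card P) * prod M P * M (S - I))"
      using u nin fin by simp
  next
    fix u assume "u \<in> (SIGMA P:?Q. {B \<in> P. x \<notin> B})"
    then obtain P B where u: "u = (P, B)" and P: "partition_on ?S P" and B: "B \<in> P" "x \<notin> B" by auto
    have BS: "B \<subseteq> S" "B \<noteq> {}" using P B by (auto simp: partition_on_def)
    then have 1: "S - (S - B) = B" by auto
    then show "(case case u of (P, B) \<Rightarrow> (S - B, P - {B}) of (I, P) \<Rightarrow> (insert (S - I) P, S - I)) = u"
      using u B by auto
    have "partition_on (\<Union>(P - {B})) (P - {B})"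
      using P by (auto simp: partition_on_def disjoint_def)
    moreover have "\<Union>(P - {B}) = insert x (S - B)"
      using P B S by (auto simp: partition_on_def disjoint_def)
    ultimately show "(case u of (P, B) \<Rightarrow> (S - B, P - {B})) \<in> (SIGMA I:{I. I \<subset> S}. {P. partition_on (insert x I) P})"
      using u BS by auto
  qed
  also have "\<dots> = (\<Sum>P\<in>?Q. card {B\<in>P. x \<notin> B} * (wgt (card P - 1) * (\<Prod>B\<in>P. M B)))"
    using finQ finP by (subst sum.Sigma[symmetric]) auto
  also have "\<dots> = (\<Sum>P\<in>?Q. (card P - 1) * (wgt (card P - 1) * (\<Prod>B\<in>P. M B)))"
  proof (intro sum.cong refl)
    fix P assume "P \<in> ?Q"
    then have P: "partition_on ?S P" by simp
    then obtain B where B: "B \<in> P" "x \<in> B" by (auto simp: partition_on_def)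
    then have "{B\<in>P. x \<notin> B} = P - {B}"
      using P by (auto simp: partition_on_def disjoint_def)
    then show "real (card {B\<in>P. x \<notin> B}) * (wgt (card P - 1) * (\<Prod>B\<in>P. M B)) =
       real (card P - 1) * (wgt (card P - 1) * (\<Prod>B\<in>P. M B))"
      using B finP[OF P] by simp
  qed
  finally have rest: "(\<Sum>I\<in>{I. I \<subset> S}. partition_cumulant M (insert x I) * M (S - I)) =
     (\<Sum>P\<in>?Q. (card P - 1) * (wgt (card P - 1) * (\<Prod>B\<in>P. M B)))" .
  have "partition_cumulant M ?S = (\<Sum>P\<in>?Q. wgt (card P) * (\<Prod>B\<in>P. M B))"
    by (simp add: partition_cumulant_def wgt_def)
  then have "subset_conv (\<lambda>I. partition_cumulant M (insert x I)) M S =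
     (\<Sum>P\<in>?Q. (wgt (card P) + (card P - 1) * wgt (card P - 1)) * (\<Prod>B\<in>P. M B))"
    unfolding subset_conv rest by (simp only: sum.distrib[symmetric] distrib_right mult.assoc)
  also have "\<dots> = (\<Sum>P\<in>?Q. if P = {?S} then M ?S else 0)"
  proof (intro sum.cong refl)
    fix P assume "P \<in> ?Q"
    then have P: "partition_on ?S P" by simp
    then have fin: "finite P" and ne: "P \<noteq> {}" using finP by (auto simp: partition_on_def)
    show "(wgt (card P) + (card P - 1) * wgt (card P - 1)) * (\<Prod>B\<in>P. M B) = (if P = {?S} then M ?S else 0)"
    proof (cases "card P = 1")
      case True
      then obtain B where "P = {B}" by (auto simp: card_1_singleton_iff)
      moreover have "B = ?S" using P \<open>P = {B}\<close> by (auto simp: partition_on_def)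
      ultimately show ?thesis by (simp add: wgt_def)
    next
      case False
      then obtain q where q: "card P = Suc (Suc q)"
        using fin ne by (metis One_nat_def card_0_eq not0_implies_Suc)
      then have "P \<noteq> {?S}" by auto
      then show ?thesis using q by (simp add: wgt_def)
    qed
  qed
  also have "\<dots> = M ?S"
    using finQ by (simp add: sum.delta partition_on_def disjoint_def)
  finally show ?thesis .
qed

text \<open>The bridge between the partition formula, symmetric in all arguments, and the quotient,
  which singles out x.\<close>

lemma partition_cumulant_eq_deconv:
  assumes "finite S" "x \<notin> S" "M {} = 1"
  shows "partition_cumulant M (insert x S) = deconv M (\<lambda>I. M (insert x I)) S"
  by (rule deconv_unique[where f = "\<lambda>I. partition_cumulant M (insert x I)"])
     (use assms in \<open>auto intro!: subset_conv_partition_cumulant intro: finite_subset\<close>)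

definition moment :: "'a measure \<Rightarrow> ('a \<Rightarrow> real) \<Rightarrow> ('i \<Rightarrow> 'a \<Rightarrow> real) \<Rightarrow> 'i set \<Rightarrow> real" where
  "moment M X T S = (\<integral>\<omega>. X \<omega> * (\<Prod>j\<in>S. T j \<omega>) \<partial>M)"

text \<open>The joint cumulant of X and the T j with j in S, normalised by
  E[X prod T] = sum_I kappa(X; I) E[prod T over S - I].\<close>
definition kappa :: "'a measure \<Rightarrow> ('a \<Rightarrow> real) \<Rightarrow> ('i \<Rightarrow> 'a \<Rightarrow> real) \<Rightarrow> 'i set \<Rightarrow> real" where
  "kappa M X T S = deconv (moment M (\<lambda>_. 1) T) (moment M X T) S"

lemma (in prob_space) moment_1_empty [simp]: "moment M (\<lambda>_. 1) T {} = 1"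
  by (simp add: moment_def prob_space)

lemma (in prob_space) cumulant_eq_kappa:
  assumes "r \<ge> 1"
  shows "cumulant M T r = kappa M (T 1) T {2..r}"
proof -
  have "cumulant M T r = partition_cumulant (moment M (\<lambda>_. 1) T) {1..r}"
    by (simp add: cumulant_def partition_cumulant_def moment_def)
  also have "{1..r} = insert 1 {2..r}" using assms by auto
  also have "partition_cumulant (moment M (\<lambda>_. 1) T) (insert 1 {2..r}) =
     deconv (moment M (\<lambda>_. 1) T) (\<lambda>I. moment M (\<lambda>_. 1) T (insert 1 I)) {2..r}"
    by (rule partition_cumulant_eq_deconv) auto
  also have "\<dots> = deconv (moment M (\<lambda>_. 1) T) (moment M (T 1) T) {2..r}"
  proof (rule deconv_cong)
    fix I :: "nat set" assume I: "I \<subseteq> {2..r}"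
    then have "finite I" "1 \<notin> I" using finite_subset by auto
    then show "moment M (\<lambda>_. 1) T (insert 1 I) = moment M (T 1) T I"
      by (simp add: moment_def)
  qed simp
  finally show ?thesis by (simp add: kappa_def)
qed

lemma (in prob_space) kappa_empty: "kappa M X T {} = expectation X"
  by (simp add: kappa_def deconv.simps moment_def)

text \<open>The Leonov-Shiryaev formula for a product of two variables, read as a recursion in the
  number of arguments that moves T_y into the first slot.\<close>

lemma (in prob_space) kappa_insert:
  assumes "finite S" "y \<notin> S"
  shows "kappa M X T (insert y S) = kappa M (\<lambda>\<omega>. X \<omega> * T y \<omega>) T S - (\<Sum>I\<in>Pow S. kappa M X T I * kappa M (T y) T (S - I))"
proof -
  have *: "finite I \<and> y \<notin> I" if "I \<subseteq> S" for I
    using that assms finite_subset by auto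
  show ?thesis
    unfolding kappa_def subset_conv_def[symmetric]
    by (rule deconv_insert) (use assms * in \<open>auto simp: moment_def mult.assoc prob_space\<close>)
qed

lemma (in prob_space) covariance_eq_kappa: "covariance M (T 1) (T 2) = kappa M (T 1) T {2::nat}"
  using kappa_insert[of "{}" 2 "T 1" T] by (simp add: kappa_empty covariance_def)

text \<open>The same formula solved for the product. The index y is merely a free slot for Y;
  updating T there does not affect cumulants over subsets of S.\<close>

lemma (in prob_space) kappa_mult:
  assumes "finite S" "y \<notin> S"
  shows "kappa M (\<lambda>\<omega>. X \<omega> * Y \<omega>) T S = kappa M X (T(y := Y)) (insert y S) + (\<Sum>I\<in>Pow S. kappa M X T I * kappa M Y T (S - I))"
proof -
  have *: "moment M X (T(y := Y)) I = moment M X T I" if "I \<subseteq> S" for I X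
    unfolding moment_def using that assms
    by (intro Bochner_Integration.integral_cong arg_cong2[where f = "(*)"] prod.cong) auto
  have **: "kappa M X (T(y := Y)) I = kappa M X T I" if "I \<subseteq> S" for I X
    unfolding kappa_def using that by (intro deconv_cong *) auto
  show ?thesis
    using kappa_insert[OF assms, of X "T(y := Y)"] sum.cong[OF refl, of "Pow S" 
      "\<lambda>I. kappa M X (T(y := Y)) I * kappa M Y (T(y := Y)) (S - I)" "\<lambda>I. kappa M X T I * kappa M Y T (S - I)"]
    by (simp add: **)
qed

lemma (in prob_space) kappa_cmult:
  assumes "finite S"
  shows "kappa M (\<lambda>\<omega>. c * X \<omega>) T S = c * kappa M X T S"
proof -
  have "moment M (\<lambda>\<omega>. c * X \<omega>) T = (\<lambda>S. c * moment M X T S)"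
    by (simp add: moment_def mult.assoc fun_eq_iff)
  then show ?thesis using assms by (simp add: kappa_def deconv_scale)
qed

lemma (in prob_space) kappa_const:
  assumes "finite S"
  shows "kappa M (\<lambda>\<omega>. c) T S = (if S = {} then c else 0)"
proof -
  have "moment M (\<lambda>\<omega>. c) T = (\<lambda>S. c * moment M (\<lambda>_. 1) T S)"
    by (simp add: moment_def fun_eq_iff)
  then show ?thesis using assms by (simp add: kappa_def deconv_const)
qed

text \<open>In the sum of \<open>kappa_insert\<close> only I = S survives, since a constant has no
  cumulant with other variables, and that term cancels the cumulant of the product.\<close>

lemma (in prob_space) kappa_insert_const:
  assumes "finite S" "y \<notin> S" "T y = (\<lambda>_. c)"
  shows "kappa M X T (insert y S) = 0"
proof -
  have "(\<Sum>I\<in>Pow S. kappa M X T I * kappa M (T y) T (S - I)) = (\<Sum>I\<in>Pow S. if I = S then kappa M X T I * c else 0)"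
    using assms by (intro sum.cong) (auto simp: kappa_const)
  also have "\<dots> = kappa M X T S * c" using assms by (simp add: sum.delta)
  finally show ?thesis
    using kappa_insert[OF assms(1,2), of X T] kappa_cmult[OF assms(1), of c X T] assms(3)
    by (simp add: mult.commute)
qed

lemma (in prob_space) kappa_cong_AE:
  assumes "AE \<omega> in M. X \<omega> = X' \<omega>" "X \<in> borel_measurable M" "X' \<in> borel_measurable M"
    "\<And>j. j \<in> S \<Longrightarrow> T j \<in> borel_measurable M"
  shows "kappa M X T S = kappa M X' T S"
proof -
  have "moment M X T I = moment M X' T I" if "I \<subseteq> S" for I
    unfolding moment_def
    by (intro integral_cong_AE borel_measurable_times borel_measurable_prod)
       (use assms that in auto)
  then show ?thesis unfolding kappa_def by (intro deconv_cong) auto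
qed

lemma (in prob_space) kappa_sum:
  assumes "finite S" and "\<And>I x. I \<subseteq> S \<Longrightarrow> x \<in> A \<Longrightarrow> integrable M (\<lambda>\<omega>. X x \<omega> * (\<Prod>j\<in>I. T j \<omega>))"
  shows "kappa M (\<lambda>\<omega>. \<Sum>x\<in>A. c x * X x \<omega>) T S = (\<Sum>x\<in>A. c x * kappa M (X x) T S)"
  unfolding kappa_def
proof (rule deconv_sum)
  fix I assume "I \<subseteq> S"
  then have "integrable M (\<lambda>\<omega>. c x * (X x \<omega> * (\<Prod>j\<in>I. T j \<omega>)))" if "x \<in> A" for x
    using assms(2) that by auto
  then show "moment M (\<lambda>\<omega>. \<Sum>x\<in>A. c x * X x \<omega>) T I = (\<Sum>x\<in>A. c x * moment M (X x) T I)"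
    unfolding moment_def
    by (simp add: sum_distrib_right mult.assoc Bochner_Integration.integral_sum)
qed (use assms in auto)

subsection \<open>Haar measure\<close>

lemma mmul_entry: "a < m \<Longrightarrow> b < m \<Longrightarrow> mmul m A B (a,b) = (\<Sum>c<m. A (a,c) * B (c,b))"
  by (simp add: mmul_def mk_mat_def)

lemma mT_entry: "a < m \<Longrightarrow> b < m \<Longrightarrow> mT m A (a,b) = A (b,a)"
  by (simp add: mT_def mk_mat_def)

lemma mk_mat_eqI: "(\<And>a b. a < m \<Longrightarrow> b < m \<Longrightarrow> f (a,b) = g (a,b)) \<Longrightarrow> mk_mat m f = mk_mat m g"
  unfolding mk_mat_def by (intro restrict_ext) auto

lemma mT_mmul: "mT m (mmul m A B) = mmul m (mT m B) (mT m A)"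
  by (simp only: mmul_def[of m "mT m B"] mT_def[of m "mmul m A B"])
     (intro mk_mat_eqI, auto simp: mmul_entry mT_entry mult.commute intro!: sum.cong)

text \<open>Transposing twice truncates to the index square, so on arbitrary functions it acts as
  the identity only inside a product.\<close>

lemma mmul_mT_mT_left: "mmul m (mT m (mT m A)) B = mmul m A B"
  unfolding mmul_def by (intro mk_mat_eqI) (auto simp: mT_entry intro!: sum.cong)

lemma mmul_mT_mT_right: "mmul m A (mT m (mT m B)) = mmul m A B"
  unfolding mmul_def by (intro mk_mat_eqI) (auto simp: mT_entry intro!: sum.cong)

lemma space_matM: "space (matM m) = ({..<m} \<times> {..<m}) \<rightarrow>\<^sub>E UNIV"
  by (simp add: matM_def space_PiM)

lemma mk_mat_space [simp, intro]: "mk_mat m f \<in> space (matM m)"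
  by (auto simp: space_matM mk_mat_def)

lemma measurable_entry [measurable (raw)]:
  "a < m \<Longrightarrow> b < m \<Longrightarrow> (\<lambda>A. A (a,b)) \<in> borel_measurable (matM m)"
  unfolding matM_def by (rule measurable_component_singleton) auto

lemma measurable_mk_mat:
  assumes "\<And>a b. a < m \<Longrightarrow> b < m \<Longrightarrow> (\<lambda>x. f x (a,b)) \<in> borel_measurable M"
  shows "(\<lambda>x. mk_mat m (f x)) \<in> measurable M (matM m)"
  unfolding mk_mat_def matM_def by (rule measurable_restrict) (use assms in auto)

lemma measurable_entry_comp:
  assumes "f \<in> measurable M (matM m)" "a < m" "b < m"
  shows "(\<lambda>x. f x (a,b)) \<in> borel_measurable M"
  using measurable_compose[OF assms(1) measurable_entry[OF assms(2,3)]] .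

lemma measurable_mmul [measurable (raw)]:
  assumes "f \<in> measurable M (matM m)" "g \<in> measurable M (matM m)"
  shows "(\<lambda>x. mmul m (f x) (g x)) \<in> measurable M (matM m)"
  unfolding mmul_def
  by (rule measurable_mk_mat) (auto intro!: borel_measurable_sum borel_measurable_times measurable_entry_comp assms)

lemma measurable_mT [measurable (raw)]:
  assumes "f \<in> measurable M (matM m)"
  shows "(\<lambda>x. mT m (f x)) \<in> measurable M (matM m)"
  unfolding mT_def by (rule measurable_mk_mat) (auto intro!: measurable_entry_comp assms)

lemma orth_matsD:
  assumes "A \<in> orth_mats m" "a < m" "b < m"
  shows "(\<Sum>c<m. A (c,a) * A (c,b)) = of_bool (a = b)"
proof -
  have "(\<Sum>c<m. A (c,a) * A (c,b)) = mmul m (mT m A) A (a,b)"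
    using assms by (simp add: mmul_entry mT_entry)
  also have "\<dots> = mid m (a,b)" using assms(1) by (simp add: orth_mats_def)
  also have "\<dots> = of_bool (a = b)" using assms by (simp add: mid_def mk_mat_def)
  finally show ?thesis .
qed

lemma orth_matsI:
  assumes "A \<in> space (matM m)" "\<And>a b. a < m \<Longrightarrow> b < m \<Longrightarrow> (\<Sum>c<m. A (c,a) * A (c,b)) = of_bool (a = b)"
  shows "A \<in> orth_mats m"
proof -
  have "mmul m (mT m A) A = mid m"
    unfolding mmul_def mid_def by (rule mk_mat_eqI) (simp add: mT_entry assms(2) of_bool_def)
  then show ?thesis using assms(1) by (simp add: orth_mats_def)
qed

text \<open>With G = A A', the matrix I - G is a symmetric idempotent of trace m - tr (A' A) = 0,
  so the sum of the squares of its entries vanishes.\<close>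
lemma orth_mats_rows:
  assumes A: "A \<in> orth_mats m" and ab: "a < m" "b < m"
  shows "(\<Sum>c<m. A (a,c) * A (b,c)) = of_bool (a = b)"
proof -
  define G where "G a b = (\<Sum>c<m. A (a,c) * A (b,c))" for a b
  have G_sq: "(\<Sum>b<m. (G a b)\<^sup>2) = G a a" for a
  proof -
    have "(\<Sum>b<m. (G a b)\<^sup>2) = (\<Sum>b<m. \<Sum>c<m. \<Sum>d<m. (A (a,c) * A (a,d)) * (A (b,c) * A (b,d)))"
      unfolding G_def power2_eq_square sum_product by (simp add: mult_ac)
    also have "\<dots> = (\<Sum>c<m. \<Sum>b<m. \<Sum>d<m. (A (a,c) * A (a,d)) * (A (b,c) * A (b,d)))"
      by (rule sum.swap)
    also have "\<dots> = (\<Sum>c<m. \<Sum>d<m. (A (a,c) * A (a,d)) * (\<Sum>b<m. A (b,c) * A (b,d)))"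
      unfolding sum_distrib_left by (intro sum.cong refl sum.swap)
    also have "\<dots> = G a a"
      using A by (simp add: orth_matsD sum_of_bool G_def del: of_bool_eq_iff)
    finally show ?thesis .
  qed
  have tr: "(\<Sum>a<m. G a a) = real m"
    unfolding G_def by (subst sum.swap) (use A in \<open>simp add: orth_matsD\<close>)
  have "(\<Sum>a<m. \<Sum>b<m. (of_bool (a = b) - G a b)\<^sup>2) = (\<Sum>a<m. 1 - G a a)"
  proof (intro sum.cong refl)
    fix a assume a: "a \<in> {..<m}"
    have "(\<Sum>b<m. (of_bool (a = b) - G a b)\<^sup>2) = (\<Sum>b<m. of_bool (a = b) * (1 - 2 * G a b) + (G a b)\<^sup>2)"
      by (intro sum.cong refl) (auto simp: power2_eq_square algebra_simps)
    also have "\<dots> = 1 - 2 * G a a + G a a"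
      using a by (simp only: sum.distrib sum_of_bool lessThan_iff G_sq)
    finally show "(\<Sum>b<m. (of_bool (a = b) - G a b)\<^sup>2) = 1 - G a a" by simp
  qed
  also have "\<dots> = 0" by (simp add: sum_subtractf tr)
  finally have 0: "(\<Sum>a<m. \<Sum>b<m. (of_bool (a = b) - G a b)\<^sup>2) = 0" .
  have "(\<Sum>b<m. (of_bool (a = b) - G a b)\<^sup>2) = 0"
    using 0 ab by (subst (asm) sum_nonneg_eq_0_iff) (auto intro: sum_nonneg)
  then have "(of_bool (a = b) - G a b)\<^sup>2 = 0"
    using ab by (subst (asm) sum_nonneg_eq_0_iff) auto
  then show ?thesis by (simp add: G_def)
qed

lemma orth_mats_mT: "A \<in> orth_mats m \<Longrightarrow> mT m A \<in> orth_mats m"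
  by (rule orth_matsI) (auto simp: mT_def mk_mat_def[of m] orth_mats_rows mk_mat_space[of m, unfolded mk_mat_def])

lemma orth_mats_entry_le_1:
  assumes "A \<in> orth_mats m" "a < m" "b < m"
  shows "\<bar>A (a,b)\<bar> \<le> 1"
proof -
  have "(A (a,b))\<^sup>2 \<le> (\<Sum>c<m. (A (c,b))\<^sup>2)"
    using assms(2) by (intro member_le_sum) auto
  also have "\<dots> = 1" using orth_matsD[OF assms(1,3,3)] by (simp add: power2_eq_square)
  finally show ?thesis by (simp add: abs_square_le_1)
qed

locale haar =
  fixes m :: nat and \<mu> :: "(nat \<times> nat \<Rightarrow> real) measure"
  assumes haar: "haar_orth m \<mu>"
begin

lemma sets_mu [measurable_cong]: "sets \<mu> = sets (matM m)"
  using haar by (simp add: haar_orth_def)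

sublocale prob_space \<mu>
  using haar by (simp add: haar_orth_def)

lemma AE_orth: "AE A in \<mu>. A \<in> orth_mats m"
  using haar by (intro AE_prob_1) (simp add: haar_orth_def measure_def)

lemma nn_integral_left:
  assumes "g \<in> borel_measurable (matM m)" "U \<in> orth_mats m"
  shows "(\<integral>\<^sup>+A. g (mmul m U A) \<partial>\<mu>) = (\<integral>\<^sup>+A. g A \<partial>\<mu>)"
proof -
  have "U \<in> space (matM m)" using assms(2) by (simp add: orth_mats_def)
  then have "mmul m U \<in> measurable \<mu> (matM m)" by measurable
  then have "(\<integral>\<^sup>+A. g (mmul m U A) \<partial>\<mu>) = (\<integral>\<^sup>+A. g A \<partial>(distr \<mu> (matM m) (mmul m U)))"
    using assms(1) by (intro nn_integral_distr[symmetric]) auto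
  also have "distr \<mu> (matM m) (mmul m U) = \<mu>"
    using haar assms(2) by (simp add: haar_orth_def)
  finally show ?thesis .
qed

text \<open>Unimodularity: integrate g (V' A) over independent V and A in both orders.\<close>
lemma nn_integral_mT:
  assumes [measurable]: "g \<in> borel_measurable (matM m)"
  shows "(\<integral>\<^sup>+A. g (mT m A) \<partial>\<mu>) = (\<integral>\<^sup>+A. g A \<partial>\<mu>)"
proof -
  interpret P: pair_sigma_finite \<mu> \<mu> ..
  have "(\<integral>\<^sup>+A. g A \<partial>\<mu>) = (\<integral>\<^sup>+V. (\<integral>\<^sup>+A. g A \<partial>\<mu>) \<partial>\<mu>)"
    by (simp add: emeasure_space_1)
  also have "\<dots> = (\<integral>\<^sup>+V. (\<integral>\<^sup>+A. g (mmul m (mT m V) A) \<partial>\<mu>) \<partial>\<mu>)"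
    by (rule nn_integral_cong_AE) (use AE_orth in eventually_elim, simp add: nn_integral_left orth_mats_mT)
  also have "\<dots> = (\<integral>\<^sup>+A. (\<integral>\<^sup>+V. g (mmul m (mT m V) A) \<partial>\<mu>) \<partial>\<mu>)"
    by (rule P.Fubini'[symmetric]) measurable
  also have "\<dots> = (\<integral>\<^sup>+A. (\<integral>\<^sup>+V. g (mT m (mmul m (mT m A) V)) \<partial>\<mu>) \<partial>\<mu>)"
    by (simp add: mT_mmul mmul_mT_mT_right)
  also have "\<dots> = (\<integral>\<^sup>+A. (\<integral>\<^sup>+V. g (mT m V) \<partial>\<mu>) \<partial>\<mu>)"
    by (rule nn_integral_cong_AE)
       (use AE_orth in eventually_elim, simp add: nn_integral_left[of "\<lambda>V. g (mT m V)"] orth_mats_mT)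
  also have "\<dots> = (\<integral>\<^sup>+V. g (mT m V) \<partial>\<mu>)"
    by (simp add: emeasure_space_1)
  finally show ?thesis ..
qed

text \<open>A U is the transpose of U' A', so invariance under transposition turns right translation
  into left translation.\<close>

lemma nn_integral_right:
  assumes [measurable]: "g \<in> borel_measurable (matM m)" and U: "U \<in> orth_mats m"
  shows "(\<integral>\<^sup>+A. g (mmul m A U) \<partial>\<mu>) = (\<integral>\<^sup>+A. g A \<partial>\<mu>)"
proof -
  have [measurable]: "mT m U \<in> space (matM m)" by (simp add: mT_def)
  have "(\<integral>\<^sup>+A. g (mmul m A U) \<partial>\<mu>) = (\<integral>\<^sup>+A. g (mT m (mmul m (mT m U) (mT m A))) \<partial>\<mu>)"
    by (simp add: mT_mmul mmul_mT_mT_left mmul_mT_mT_right)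
  also have "\<dots> = (\<integral>\<^sup>+A. g (mT m (mmul m (mT m U) A)) \<partial>\<mu>)"
    by (rule nn_integral_mT[of "\<lambda>A. g (mT m (mmul m (mT m U) A))"]) measurable
  also have "\<dots> = (\<integral>\<^sup>+A. g (mT m A) \<partial>\<mu>)"
    by (rule nn_integral_left[of "\<lambda>A. g (mT m A)"]) (use U orth_mats_mT in auto)
  also have "\<dots> = (\<integral>\<^sup>+A. g A \<partial>\<mu>)" by (rule nn_integral_mT) simp
  finally show ?thesis .
qed

lemma distr_right:
  assumes U: "U \<in> orth_mats m"
  shows "distr \<mu> \<mu> (\<lambda>A. mmul m A U) = \<mu>"
proof (rule measure_eqI)
  fix B assume "B \<in> sets (distr \<mu> \<mu> (\<lambda>A. mmul m A U))"
  then have B: "B \<in> sets \<mu>" and [measurable]: "B \<in> sets (matM m)" by (simp_all add: sets_mu)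
  have [measurable]: "U \<in> space (matM m)" using U by (simp add: orth_mats_def)
  have meas: "(\<lambda>A. mmul m A U) \<in> measurable \<mu> \<mu>" by measurable
  have "emeasure (distr \<mu> \<mu> (\<lambda>A. mmul m A U)) B = (\<integral>\<^sup>+A. indicator B A \<partial>(distr \<mu> \<mu> (\<lambda>A. mmul m A U)))"
    using B by simp
  also have "\<dots> = (\<integral>\<^sup>+A. indicator B (mmul m A U) \<partial>\<mu>)"
    using B by (intro nn_integral_distr meas) simp
  also have "\<dots> = (\<integral>\<^sup>+A. indicator B A \<partial>\<mu>)"
    by (rule nn_integral_right[OF _ U]) simp
  finally show "emeasure (distr \<mu> \<mu> (\<lambda>A. mmul m A U)) B = emeasure \<mu> B" using B by simp
qed simp

end

text \<open>Rotation by t in the plane of the coordinates a and b, given on all indices and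
  truncated by \<open>mk_mat\<close> where it is used. With this sign its derivative at t = 0 is
  E_ab - E_ba.\<close>

definition plane_rot :: "nat \<Rightarrow> nat \<Rightarrow> real \<Rightarrow> nat \<times> nat \<Rightarrow> real" where
  "plane_rot a b t = (\<lambda>(c,d). if d = a then cos t * of_bool (c = a) - sin t * of_bool (c = b)
     else if d = b then sin t * of_bool (c = a) + cos t * of_bool (c = b) else of_bool (c = d))"

lemma sum_plane_rot:
  assumes "a < m" "b < m" "a \<noteq> b" "e < m"
  shows "(\<Sum>c<m. plane_rot a b t (c,e) * g c) = (if e = a then cos t * g a - sin t * g b
     else if e = b then sin t * g a + cos t * g b else g e)"
proof -
  have "(\<Sum>c<m. (x * of_bool (c = a) + y * of_bool (c = b)) * g c) = x * g a + y * g b" for x y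
    using assms by (simp only: distrib_right mult.assoc sum.distrib sum_distrib_left[symmetric] sum_of_bool)
  from this[of "cos t" "- sin t"] this[of "sin t" "cos t"] show ?thesis
    using assms by (simp add: plane_rot_def sum_of_bool del: of_bool_eq_iff)
qed

lemma plane_rot_orth:
  assumes "a < m" "b < m" "a \<noteq> b"
  shows "mk_mat m (plane_rot a b t) \<in> orth_mats m"
proof (rule orth_matsI)
  fix e f assume ef: "e < m" "f < m"
  have "(\<Sum>c<m. plane_rot a b t (c,e) * plane_rot a b t (c,f)) = of_bool (e = f)"
    unfolding sum_plane_rot[OF assms ef(1)] using assms(3) sin_cos_squared_add3[of t]
    by (auto simp: plane_rot_def algebra_simps)
  then show "(\<Sum>c<m. mk_mat m (plane_rot a b t) (c,e) * mk_mat m (plane_rot a b t) (c,f)) = of_bool (e = f)"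
    using ef by (simp add: mk_mat_def)
qed auto

subsection \<open>First order expansions\<close>

text \<open>First order Taylor expansion at t = 0, where one constant bounds value, derivative and
  remainder on all of S. The bounds on \<open>g\<close> and \<open>g'\<close> make the notion stable
  under products, and uniformity replaces differentiation under the integral.\<close>

definition uniform_expansion :: "'a set \<Rightarrow> (real \<Rightarrow> 'a \<Rightarrow> real) \<Rightarrow> ('a \<Rightarrow> real) \<Rightarrow> bool" where
  "uniform_expansion S g g' \<longleftrightarrow> (\<exists>C. \<forall>x\<in>S. \<forall>t. \<bar>t\<bar> \<le> 1 \<longrightarrow>
     \<bar>g t x\<bar> \<le> C \<and> \<bar>g' x\<bar> \<le> C \<and> \<bar>g t x - g 0 x - t * g' x\<bar> \<le> C * t\<^sup>2)"

lemma uniform_expansion_const: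
  assumes "\<And>x. x \<in> S \<Longrightarrow> \<bar>g x\<bar> \<le> B"
  shows "uniform_expansion S (\<lambda>_. g) (\<lambda>_. 0)"
  unfolding uniform_expansion_def
proof (intro exI[of _ "max B 0"] ballI allI impI conjI)
  fix x assume "x \<in> S"
  from assms[OF this] show "\<bar>g x\<bar> \<le> max B 0" by simp
qed auto

lemma uniform_expansion_add:
  assumes "uniform_expansion S f f'" "uniform_expansion S g g'"
  shows "uniform_expansion S (\<lambda>t x. f t x + g t x) (\<lambda>x. f' x + g' x)"
proof -
  obtain C where C: "\<And>x t. x \<in> S \<Longrightarrow> \<bar>t\<bar> \<le> 1 \<Longrightarrow>
     \<bar>f t x\<bar> \<le> C \<and> \<bar>f' x\<bar> \<le> C \<and> \<bar>f t x - f 0 x - t * f' x\<bar> \<le> C * t\<^sup>2"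
    using assms(1) unfolding uniform_expansion_def by blast
  obtain D where D: "\<And>x t. x \<in> S \<Longrightarrow> \<bar>t\<bar> \<le> 1 \<Longrightarrow>
     \<bar>g t x\<bar> \<le> D \<and> \<bar>g' x\<bar> \<le> D \<and> \<bar>g t x - g 0 x - t * g' x\<bar> \<le> D * t\<^sup>2"
    using assms(2) unfolding uniform_expansion_def by blast
  show ?thesis unfolding uniform_expansion_def
  proof (intro exI[of _ "C + D"] ballI allI impI)
    fix x t assume "x \<in> S" "\<bar>t\<bar> \<le> (1::real)"
    from C[OF this] D[OF this]
    show "\<bar>f t x + g t x\<bar> \<le> C + D \<and> \<bar>f' x + g' x\<bar> \<le> C + D \<and>
        \<bar>f t x + g t x - (f 0 x + g 0 x) - t * (f' x + g' x)\<bar> \<le> (C + D) * t\<^sup>2"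
      unfolding distrib_left distrib_right by linarith
  qed
qed

lemma uniform_expansion_mult:
  assumes "uniform_expansion S f f'" "uniform_expansion S g g'"
  shows "uniform_expansion S (\<lambda>t x. f t x * g t x) (\<lambda>x. f' x * g 0 x + f 0 x * g' x)"
proof -
  obtain C where C: "\<And>x t. x \<in> S \<Longrightarrow> \<bar>t\<bar> \<le> 1 \<Longrightarrow>
     \<bar>f t x\<bar> \<le> C \<and> \<bar>f' x\<bar> \<le> C \<and> \<bar>f t x - f 0 x - t * f' x\<bar> \<le> C * t\<^sup>2"
    using assms(1) unfolding uniform_expansion_def by blast
  obtain D where D: "\<And>x t. x \<in> S \<Longrightarrow> \<bar>t\<bar> \<le> 1 \<Longrightarrow>
     \<bar>g t x\<bar> \<le> D \<and> \<bar>g' x\<bar> \<le> D \<and> \<bar>g t x - g 0 x - t * g' x\<bar> \<le> D * t\<^sup>2"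
    using assms(2) unfolding uniform_expansion_def by blast
  show ?thesis unfolding uniform_expansion_def
  \<comment> \<open>4 = 1 + 2 + 1: the remainder of f times g; the remainder of g times f 0 + t f',
    which is at most 2 C; and the second order term with f' g'.\<close>
  proof (intro exI[of _ "4 * (C * D)"] ballI allI impI)
    fix x t assume x: "x \<in> S" "\<bar>t\<bar> \<le> (1::real)"
    have 0: "C \<ge> 0" "D \<ge> 0" using C[OF x] D[OF x] by linarith+
    then have CD: "C * D \<ge> 0" by simp
    have f0: "\<bar>f 0 x\<bar> \<le> C" and g0: "\<bar>g 0 x\<bar> \<le> D" using C[OF x(1), of 0] D[OF x(1), of 0] by auto
    have 1: "\<bar>f t x * g t x\<bar> \<le> C * D"
      unfolding abs_mult using C[OF x] D[OF x] 0 by (intro mult_mono) auto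
    have 2: "\<bar>f' x * g 0 x\<bar> \<le> C * D" "\<bar>f 0 x * g' x\<bar> \<le> C * D" "\<bar>f' x * g' x\<bar> \<le> C * D"
      unfolding abs_mult using C[OF x] D[OF x] f0 g0 0 by (auto intro!: mult_mono)
    have tf: "\<bar>t * f' x\<bar> \<le> 1 * C" unfolding abs_mult using C[OF x] x by (intro mult_mono) auto
    have F: "\<bar>f 0 x + t * f' x\<bar> \<le> 2 * C" using f0 tf by linarith
    have r: "f t x * g t x - f 0 x * g 0 x - t * (f' x * g 0 x + f 0 x * g' x) =
       (f t x - f 0 x - t * f' x) * g t x + (f 0 x + t * f' x) * (g t x - g 0 x - t * g' x) + t\<^sup>2 * (f' x * g' x)"
      by (simp add: algebra_simps power2_eq_square)
    have 3: "\<bar>(f t x - f 0 x - t * f' x) * g t x\<bar> \<le> (C * t\<^sup>2) * D"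
      unfolding abs_mult using C[OF x] D[OF x] 0 by (intro mult_mono) auto
    have 4: "\<bar>(f 0 x + t * f' x) * (g t x - g 0 x - t * g' x)\<bar> \<le> (2 * C) * (D * t\<^sup>2)"
      unfolding abs_mult using D[OF x] F 0 by (intro mult_mono) auto
    have 5: "\<bar>t\<^sup>2 * (f' x * g' x)\<bar> \<le> t\<^sup>2 * (C * D)"
      unfolding abs_mult[of "t\<^sup>2"] using 2(3) by (intro mult_mono) auto
    have "\<bar>f t x * g t x - f 0 x * g 0 x - t * (f' x * g 0 x + f 0 x * g' x)\<bar>
      \<le> (C * t\<^sup>2) * D + (2 * C) * (D * t\<^sup>2) + t\<^sup>2 * (C * D)"
      unfolding r using 3 4 5 by linarith
    also have "\<dots> = 4 * (C * D) * t\<^sup>2" by (simp add: algebra_simps)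
    finally show "\<bar>f t x * g t x\<bar> \<le> 4 * (C * D) \<and> \<bar>f' x * g 0 x + f 0 x * g' x\<bar> \<le> 4 * (C * D) \<and>
       \<bar>f t x * g t x - f 0 x * g 0 x - t * (f' x * g 0 x + f 0 x * g' x)\<bar> \<le> 4 * (C * D) * t\<^sup>2"
      using 1 2 CD by linarith
  qed
qed

lemma uniform_expansion_sum:
  assumes "finite A" "\<And>a. a \<in> A \<Longrightarrow> uniform_expansion S (f a) (f' a)"
  shows "uniform_expansion S (\<lambda>t x. \<Sum>a\<in>A. f a t x) (\<lambda>x. \<Sum>a\<in>A. f' a x)"
  using assms by (induction A rule: finite_induct) (auto intro: uniform_expansion_add uniform_expansion_const[of _ _ 0])

lemma uniform_expansion_prod:
  assumes "finite A" "\<And>a. a \<in> A \<Longrightarrow> uniform_expansion S (f a) (f' a)"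
  shows "uniform_expansion S (\<lambda>t x. \<Prod>a\<in>A. f a t x) (\<lambda>x. \<Sum>a\<in>A. f' a x * (\<Prod>b\<in>A - {a}. f b 0 x))"
  using assms
proof (induction A rule: finite_induct)
  case (insert a A)
  have "(\<lambda>x. f' a x * (\<Prod>b\<in>A. f b 0 x) + f a 0 x * (\<Sum>c\<in>A. f' c x * (\<Prod>b\<in>A - {c}. f b 0 x))) =
     (\<lambda>x. \<Sum>c\<in>insert a A. f' c x * (\<Prod>b\<in>insert a A - {c}. f b 0 x))"
  proof
    fix x
    have "f a 0 x * (\<Sum>c\<in>A. f' c x * (\<Prod>b\<in>A - {c}. f b 0 x)) =
        (\<Sum>c\<in>A. f' c x * (\<Prod>b\<in>insert a A - {c}. f b 0 x))"
      unfolding sum_distrib_left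
    proof (intro sum.cong refl)
      fix c assume "c \<in> A"
      then have "insert a A - {c} = insert a (A - {c})" using insert.hyps by auto
      then show "f a 0 x * (f' c x * (\<Prod>b\<in>A - {c}. f b 0 x)) = f' c x * (\<Prod>b\<in>insert a A - {c}. f b 0 x)"
        using insert.hyps by simp
    qed
    then show "f' a x * (\<Prod>b\<in>A. f b 0 x) + f a 0 x * (\<Sum>c\<in>A. f' c x * (\<Prod>b\<in>A - {c}. f b 0 x)) =
     (\<Sum>c\<in>insert a A. f' c x * (\<Prod>b\<in>insert a A - {c}. f b 0 x))"
      using insert.hyps by simp
  qed
  with uniform_expansion_mult[OF insert.prems[of a] insert.IH] insert.prems insert.hyps show ?case by simp
qed (auto intro: uniform_expansion_const[of _ _ 1])

lemma uniform_expansion_cong: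
  assumes "uniform_expansion S f f'" "\<And>t x. x \<in> S \<Longrightarrow> f t x = g t x" "\<And>x. x \<in> S \<Longrightarrow> f' x = g' x"
  shows "uniform_expansion S g g'"
proof -
  obtain C where C: "\<And>x t. x \<in> S \<Longrightarrow> \<bar>t\<bar> \<le> 1 \<Longrightarrow>
     \<bar>f t x\<bar> \<le> C \<and> \<bar>f' x\<bar> \<le> C \<and> \<bar>f t x - f 0 x - t * f' x\<bar> \<le> C * t\<^sup>2"
    using assms(1) unfolding uniform_expansion_def by blast
  show ?thesis
    unfolding uniform_expansion_def using C by (intro exI[of _ C]) (simp add: assms(2,3)[symmetric])
qed

text \<open>If E[g t] does not depend on t, dividing the expansion by t and letting t tend to 0
  kills the first order term.\<close>
lemma (in prob_space) uniform_expansion_expectation: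
  assumes "uniform_expansion S g g'" and S: "AE x in M. x \<in> S"
    and meas: "\<And>t. g t \<in> borel_measurable M" "g' \<in> borel_measurable M"
    and eq: "\<And>t. expectation (g t) = expectation (g 0)"
  shows "expectation g' = 0"
proof -
  obtain C where C: "\<And>x t. x \<in> S \<Longrightarrow> \<bar>t\<bar> \<le> 1 \<Longrightarrow>
     \<bar>g t x\<bar> \<le> C \<and> \<bar>g' x\<bar> \<le> C \<and> \<bar>g t x - g 0 x - t * g' x\<bar> \<le> C * t\<^sup>2"
    using assms(1) unfolding uniform_expansion_def by blast
  have int: "integrable M (g t)" if "\<bar>t\<bar> \<le> 1" for t
    by (rule integrable_const_bound[of _ C], use S in eventually_elim) (use C that meas in auto)
  have int': "integrable M g'"
    by (rule integrable_const_bound[of _ C], use S in eventually_elim) (use C[of _ 0] meas in auto)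
  have bound: "\<bar>expectation g'\<bar> \<le> C * t" if t: "0 < t" "t \<le> 1" for t
  proof -
    have 1: "expectation (\<lambda>x. g t x - g 0 x - t * g' x) = - t * expectation g'"
      using t int[of t] int[of 0] int' eq[of t] by simp
    have "\<bar>expectation (\<lambda>x. g t x - g 0 x - t * g' x)\<bar> \<le> expectation (\<lambda>x. \<bar>g t x - g 0 x - t * g' x\<bar>)"
      by (rule integral_abs_bound)
    also have "\<dots> \<le> expectation (\<lambda>x. C * t\<^sup>2)"
    proof (rule integral_mono_AE)
      show "integrable M (\<lambda>x. \<bar>g t x - g 0 x - t * g' x\<bar>)"
        using t int[of t] int[of 0] int' by auto
      show "AE x in M. \<bar>g t x - g 0 x - t * g' x\<bar> \<le> C * t\<^sup>2"
        using S by eventually_elim (use C t in auto)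
    qed simp
    finally have "t * \<bar>expectation g'\<bar> \<le> t * (C * t)"
      using 1 t by (simp add: abs_mult prob_space power2_eq_square mult_ac)
    then show ?thesis using t by (simp add: mult_le_cancel_left)
  qed
  have "((\<lambda>t. C * t) \<longlongrightarrow> C * 0) (at_right 0)"
    by (intro tendsto_intros)
  moreover have "eventually (\<lambda>t. \<bar>expectation g'\<bar> \<le> C * t) (at_right (0::real))"
    using eventually_at_right_less[of "0::real"] eventually_at_right_real[OF zero_less_one] 
    by eventually_elim (use bound in auto)
  ultimately have "\<bar>expectation g'\<bar> \<le> C * 0"
    by (intro tendsto_lowerbound) auto
  then show ?thesis by simp
qed

lemma cos_expand: "\<bar>cos t - 1\<bar> \<le> t\<^sup>2" and sin_expand: "\<bar>sin t - t\<bar> \<le> t\<^sup>2" if "\<bar>t\<bar> \<le> 1" for t :: real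
proof -
  have c: "cos t = 1 - 2 * (sin (t / 2))\<^sup>2" using cos_double_sin[of "t / 2"] by simp
  have "(sin (t / 2))\<^sup>2 \<le> (t / 2)\<^sup>2"
    using abs_sin_x_le_abs_x[of "t / 2"] abs_le_square_iff by blast
  then have s: "(sin (t / 2))\<^sup>2 \<le> t\<^sup>2 / 4" by (simp add: power_divide)
  have "0 \<le> (sin (t / 2))\<^sup>2" by simp
  with c s show "\<bar>cos t - 1\<bar> \<le> t\<^sup>2" by linarith
  \<comment> \<open>The Maclaurin remainder of order 2 is at most t^2 / 2, and the factor 2 clears
    its denominator.\<close>
  have "\<bar>sin t - t\<bar> \<le> \<bar>sin t - t\<bar> * 2" by simp
  also have "\<dots> \<le> t\<^sup>2"
    using Maclaurin_sin_bound[of t 2] by (simp add: numeral_2_eq_2 sin_coeff_def)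
  finally show "\<bar>sin t - t\<bar> \<le> t\<^sup>2" .
qed

lemma uniform_expansion_cos: "uniform_expansion S (\<lambda>t _. cos t) (\<lambda>_. 0)"
  unfolding uniform_expansion_def using cos_expand by (intro exI[of _ 1]) auto

lemma uniform_expansion_sin: "uniform_expansion S (\<lambda>t _. sin t) (\<lambda>_. 1)"
  unfolding uniform_expansion_def using sin_expand by (intro exI[of _ 1]) auto

subsection \<open>Rotation invariance\<close>

text \<open>Entries of O_l' P_l O_l, as a sum over the first p_l rows of O_l. The sum stops at m
  because p_l may exceed m for small n; hence the trace \<open>min (p l) m\<close> below.\<close>

definition proj_mat :: "nat \<Rightarrow> (nat \<Rightarrow> nat) \<Rightarrow> (nat \<Rightarrow> nat \<times> nat \<Rightarrow> real) \<Rightarrow> nat \<Rightarrow> nat \<Rightarrow> nat \<Rightarrow> real" where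
  "proj_mat m p \<omega> l a b = (\<Sum>x<m. of_bool (x < p l) * (\<omega> l (x,a) * \<omega> l (x,b)))"

lemma proj_mat_sym: "proj_mat m p \<omega> l a b = proj_mat m p \<omega> l b a"
  by (simp add: proj_mat_def mult.commute)

text \<open>Orthonormality of the rows collapses the double sum. The alternative
  \<open>p l = 0\<close> is for letters outside {1..k}, where \<open>\<omega> l\<close> is arbitrary
  but the projection is zero.\<close>

lemma proj_mat_idem:
  assumes "\<omega> l \<in> orth_mats m \<or> p l = 0"
  shows "(\<Sum>c<m. proj_mat m p \<omega> l a c * proj_mat m p \<omega> l c b) = proj_mat m p \<omega> l a b"
  using assms
proof
  assume O: "\<omega> l \<in> orth_mats m"
  have "(\<Sum>c<m. proj_mat m p \<omega> l a c * proj_mat m p \<omega> l c b) =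
     (\<Sum>c<m. \<Sum>x<m. \<Sum>y<m. of_bool (x < p l) * \<omega> l (x,a) * of_bool (y < p l) * \<omega> l (y,b) * (\<omega> l (x,c) * \<omega> l (y,c)))"
    unfolding proj_mat_def sum_product by (simp add: mult_ac)
  also have "\<dots> = (\<Sum>x<m. \<Sum>y<m. of_bool (x < p l) * \<omega> l (x,a) * of_bool (y < p l) * \<omega> l (y,b) * (\<Sum>c<m. \<omega> l (x,c) * \<omega> l (y,c)))"
    unfolding sum_distrib_left by (subst sum.swap, rule sum.cong[OF refl], rule sum.swap)
  also have "\<dots> = (\<Sum>x<m. of_bool (x < p l) * \<omega> l (x,a) * of_bool (x < p l) * \<omega> l (x,b))"
    using O by (simp add: orth_mats_rows sum_of_bool del: of_bool_eq_iff)
  also have "\<dots> = proj_mat m p \<omega> l a b" unfolding proj_mat_def by (intro sum.cong) auto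
  finally show ?thesis .
qed (simp add: proj_mat_def)

lemma proj_mat_bound:
  assumes "\<omega> l \<in> orth_mats m \<or> p l = 0" "a < m" "b < m"
  shows "\<bar>proj_mat m p \<omega> l a b\<bar> \<le> real m"
  using assms(1)
proof
  assume O: "\<omega> l \<in> orth_mats m"
  have "\<bar>proj_mat m p \<omega> l a b\<bar> \<le> (\<Sum>x<m. 1 * (1 * 1))"
    unfolding proj_mat_def using assms
    by (intro order_trans[OF sum_abs] sum_mono)
       (auto simp: abs_mult intro!: mult_le_one orth_mats_entry_le_1[OF O])
  then show ?thesis by simp
qed (simp add: proj_mat_def)

lemma word_trace_single_proj_mat:
  assumes "\<omega> l \<in> orth_mats m \<or> p l = 0"
  shows "word_trace m (proj_mat m p \<omega>) [l] = real (min (p l) m)"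
  using assms
proof
  assume O: "\<omega> l \<in> orth_mats m"
  have "word_trace m (proj_mat m p \<omega>) [l] = (\<Sum>a<m. \<Sum>x<m. of_bool (x < p l) * (\<omega> l (x,a) * \<omega> l (x,a)))"
    unfolding word_trace_def by (intro sum.cong) (simp_all add: word_entry_single proj_mat_def)
  also have "\<dots> = (\<Sum>x<m. of_bool (x < p l) * (\<Sum>a<m. \<omega> l (x,a) * \<omega> l (x,a)))"
    unfolding sum_distrib_left by (rule sum.swap)
  also have "\<dots> = (\<Sum>x<m. of_bool (x < p l))"
    using O by (intro sum.cong) (simp_all add: orth_mats_rows)
  also have "\<dots> = real (card ({..<m} \<inter> {x. x < p l}))"
    by (simp add: of_bool_def sum.If_cases)
  also have "{..<m} \<inter> {x. x < p l} = {..<min (p l) m}" by auto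
  finally show ?thesis by simp
qed (simp add: proj_mat_def word_trace_def word_entry_single)

lemma plane_rot_0: "plane_rot a b 0 (c,d) = of_bool (c = d)"
  by (simp add: plane_rot_def)

text \<open>Rotating O_i by plane_rot a b t turns A_i into R' A_i R, whose derivative at t = 0 is [A_i, X].\<close>
lemma uniform_expansion_proj_mat:
  assumes ab: "a < m" "b < m" "a \<noteq> b" and cd: "c < m" "d < m"
    and S: "\<And>\<omega>. \<omega> \<in> S \<Longrightarrow> \<omega> i \<in> orth_mats m"
  shows "uniform_expansion S (\<lambda>t \<omega>. proj_mat m p ((\<omega>) (i := mmul m (\<omega> i) (mk_mat m (plane_rot a b t)))) i c d)
     (\<lambda>\<omega>. comm_entry (proj_mat m p \<omega>) i a b c d)"
proof -
  \<comment> \<open>The entries of E_ab - E_ba, that is, the derivative of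
    \<open>plane_rot a b t\<close> at t = 0.\<close>
  define X :: "nat \<Rightarrow> nat \<Rightarrow> real" where
    "X c d = (if d = a then - of_bool (c = b) else if d = b then of_bool (c = a) else 0)" for c d
  have X: "(\<Sum>e<m. X e f * g e) = of_bool (f = b) * g a - of_bool (f = a) * g b" for f g
    using ab by (auto simp: X_def sum_of_bool sum_negf simp del: of_bool_eq_iff)
  have exp_rot: "uniform_expansion S (\<lambda>t _. plane_rot a b t (e,f)) (\<lambda>_. X e f)" for e f
  proof -
    have 1: "uniform_expansion S (\<lambda>t _. cos t * of_bool (e = a) + sin t * (- of_bool (e = b))) (\<lambda>_. - of_bool (e = b))"
      by (rule uniform_expansion_cong[OF uniform_expansion_add[OF uniform_expansion_mult[OF uniform_expansion_cos uniform_expansion_const[of _ "\<lambda>_. of_bool (e = a)" 1]]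
          uniform_expansion_mult[OF uniform_expansion_sin uniform_expansion_const[of _ "\<lambda>_. - of_bool (e = b)" 1]]]]) auto
    have 2: "uniform_expansion S (\<lambda>t _. sin t * of_bool (e = a) + cos t * of_bool (e = b)) (\<lambda>_. of_bool (e = a))"
      by (rule uniform_expansion_cong[OF uniform_expansion_add[OF uniform_expansion_mult[OF uniform_expansion_sin uniform_expansion_const[of _ "\<lambda>_. of_bool (e = a)" 1]]
          uniform_expansion_mult[OF uniform_expansion_cos uniform_expansion_const[of _ "\<lambda>_. of_bool (e = b)" 1]]]]) auto
    have 3: "uniform_expansion S (\<lambda>t _. of_bool (e = f)) (\<lambda>_. 0)" by (rule uniform_expansion_const[of _ _ 1]) simp
    show ?thesis using 1 2 3 by (simp add: plane_rot_def X_def)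
  qed
  have eq: "proj_mat m p ((\<omega>) (i := mmul m (\<omega> i) (mk_mat m (plane_rot a b t)))) i c d =
     (\<Sum>e<m. \<Sum>f<m. plane_rot a b t (e,c) * proj_mat m p \<omega> i e f * plane_rot a b t (f,d))" for \<omega> t
  proof -
    have "proj_mat m p ((\<omega>) (i := mmul m (\<omega> i) (mk_mat m (plane_rot a b t)))) i c d =
       (\<Sum>x<m. of_bool (x < p i) * ((\<Sum>e<m. \<omega> i (x,e) * plane_rot a b t (e,c)) * (\<Sum>f<m. \<omega> i (x,f) * plane_rot a b t (f,d))))"
      using cd by (simp add: proj_mat_def mmul_entry mk_mat_def)
    also have "\<dots> = (\<Sum>x<m. \<Sum>e<m. \<Sum>f<m. plane_rot a b t (e,c) * (of_bool (x < p i) * (\<omega> i (x,e) * \<omega> i (x,f))) * plane_rot a b t (f,d))"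
      unfolding sum_product unfolding sum_distrib_left by (simp add: mult_ac)
    also have "\<dots> = (\<Sum>e<m. \<Sum>f<m. plane_rot a b t (e,c) * proj_mat m p \<omega> i e f * plane_rot a b t (f,d))"
      unfolding proj_mat_def sum_distrib_left sum_distrib_right
      by (subst sum.swap, rule sum.cong[OF refl], rule sum.swap)
    finally show ?thesis .
  qed
  have "uniform_expansion S (\<lambda>t \<omega>. \<Sum>e<m. \<Sum>f<m. plane_rot a b t (e,c) * proj_mat m p \<omega> i e f * plane_rot a b t (f,d))
     (\<lambda>\<omega>. \<Sum>e<m. \<Sum>f<m. (X e c * proj_mat m p \<omega> i e f + plane_rot a b 0 (e,c) * 0) * plane_rot a b 0 (f,d) +
        plane_rot a b 0 (e,c) * proj_mat m p \<omega> i e f * X f d)"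
    by (intro uniform_expansion_sum uniform_expansion_mult[OF uniform_expansion_mult[OF exp_rot uniform_expansion_const[of _ _ "real m"]] exp_rot] finite_lessThan)
       (auto intro!: proj_mat_bound S)
  moreover have "(\<Sum>e<m. \<Sum>f<m. (X e c * proj_mat m p \<omega> i e f + plane_rot a b 0 (e,c) * 0) * plane_rot a b 0 (f,d) +
        plane_rot a b 0 (e,c) * proj_mat m p \<omega> i e f * X f d) = comm_entry (proj_mat m p \<omega>) i a b c d" for \<omega>
  proof -
    have "(\<Sum>e<m. \<Sum>f<m. (X e c * proj_mat m p \<omega> i e f + plane_rot a b 0 (e,c) * 0) * plane_rot a b 0 (f,d) +
        plane_rot a b 0 (e,c) * proj_mat m p \<omega> i e f * X f d) =
       (\<Sum>e<m. X e c * (\<Sum>f<m. proj_mat m p \<omega> i e f * of_bool (f = d))) + (\<Sum>e<m. of_bool (e = c) * (\<Sum>f<m. X f d * proj_mat m p \<omega> i e f))"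
      unfolding plane_rot_0 sum_distrib_left sum.distrib[symmetric]
      by (intro sum.cong refl) (simp add: mult_ac)
    also have "\<dots> = (\<Sum>e<m. X e c * proj_mat m p \<omega> i e d) + (\<Sum>f<m. X f d * proj_mat m p \<omega> i c f)"
      using cd by (simp only: sum_of_bool)
    also have "\<dots> = comm_entry (proj_mat m p \<omega>) i a b c d"
      unfolding X by (simp add: comm_entry_def eq_commute)
    finally show ?thesis .
  qed
  ultimately show ?thesis by (simp add: eq)
qed

text \<open>Words may use any natural number as a letter. With rank 0 outside {1..k} the additional
  matrices vanish, and no condition on the letters has to be carried along.\<close>

locale projection_model = haar +
  fixes k :: nat and p :: "nat \<Rightarrow> nat"
  assumes p_outside: "l \<notin> {1..k} \<Longrightarrow> p l = 0"
begin

definition Om :: "(nat \<Rightarrow> nat \<times> nat \<Rightarrow> real) measure" where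
  "Om = PiM {1..k} (\<lambda>_. \<mu>)"

abbreviation "A \<equiv> proj_mat m p"

sublocale P: prob_space Om
  unfolding Om_def by (rule prob_space_PiM) (rule prob_space_axioms)

text \<open>The almost sure event on which the projection identities and all bounds hold
  pointwise.\<close>

definition good :: "(nat \<Rightarrow> nat \<times> nat \<Rightarrow> real) set" where
  "good = {\<omega>. \<forall>i\<in>{1..k}. \<omega> i \<in> orth_mats m}"

lemma AE_good: "AE \<omega> in Om. \<omega> \<in> good"
  unfolding good_def mem_Collect_eq Om_def
  by (intro AE_ball_countable[THEN iffD2] ballI AE_PiM_component[where P = "\<lambda>A. A \<in> orth_mats m"] AE_orth)
     (auto intro: prob_space_axioms)

lemma good_or: "\<omega> \<in> good \<Longrightarrow> \<omega> l \<in> orth_mats m \<or> p l = 0"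
  using p_outside[of l] by (auto simp: good_def)

lemma A_measurable [measurable]:
  assumes "a < m" "b < m"
  shows "(\<lambda>\<omega>. A \<omega> l a b) \<in> borel_measurable Om"
proof (cases "l \<in> {1..k}")
  case True
  have "(\<lambda>\<omega>. \<omega> l) \<in> measurable Om (matM m)"
    unfolding Om_def using measurable_component_singleton[OF True, of "\<lambda>_. \<mu>"]
    by (simp add: measurable_cong_sets[OF refl sets_mu])
  then show ?thesis
    unfolding proj_mat_def using assms
    by (intro borel_measurable_sum borel_measurable_times borel_measurable_const measurable_entry_comp) auto
qed (simp add: proj_mat_def p_outside)

lemma word_entry_measurable [measurable]:
  "a < m \<Longrightarrow> b < m \<Longrightarrow> (\<lambda>\<omega>. word_entry m (A \<omega>) w a b) \<in> borel_measurable Om"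
  by (induction w arbitrary: a) (auto simp: word_entry_Cons)

lemma word_trace_measurable [measurable]: "(\<lambda>\<omega>. word_trace m (A \<omega>) w) \<in> borel_measurable Om"
  unfolding word_trace_def by measurable

lemma word_deriv_measurable [measurable]:
  "a < m \<Longrightarrow> b < m \<Longrightarrow> c < m \<Longrightarrow> d < m \<Longrightarrow> (\<lambda>\<omega>. word_deriv m (A \<omega>) i a b w c d) \<in> borel_measurable Om"
  unfolding word_deriv_def by measurable

lemma word_trace_bound_good: "\<omega> \<in> good \<Longrightarrow> \<bar>word_trace m (A \<omega>) w\<bar> \<le> real m ^ (2 * length w + 1)"
  by (rule word_trace_bound) (rule proj_mat_bound, rule good_or)

lemma word_entry_bound_good: "\<omega> \<in> good \<Longrightarrow> a < m \<Longrightarrow> b < m \<Longrightarrow> \<bar>word_entry m (A \<omega>) w a b\<bar> \<le> real m ^ (2 * length w)"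
  by (rule word_entry_bound) (rule proj_mat_bound, rule good_or)

definition rotate :: "nat \<Rightarrow> nat \<Rightarrow> nat \<Rightarrow> real \<Rightarrow> (nat \<Rightarrow> nat \<times> nat \<Rightarrow> real) \<Rightarrow> (nat \<Rightarrow> nat \<times> nat \<Rightarrow> real)" where
  "rotate i a b t \<omega> = (\<omega>) (i := mmul m (\<omega> i) (mk_mat m (plane_rot a b t)))"

text \<open>Right invariance of one factor of the product measure, checked on boxes: the i-th side
  is replaced by its preimage, which has the same measure.\<close>

lemma rotate_distr:
  assumes "i \<in> {1..k}" "a < m" "b < m" "a \<noteq> b"
  shows "rotate i a b t \<in> measurable Om Om" "distr Om Om (rotate i a b t) = Om"
proof -
  let ?R = "\<lambda>A. mmul m A (mk_mat m (plane_rot a b t))"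
  have R: "distr \<mu> \<mu> ?R = \<mu>" by (rule distr_right[OF plane_rot_orth]) (use assms in auto)
  have meas_R: "?R \<in> measurable \<mu> \<mu>"
  proof -
    have [measurable]: "mk_mat m (plane_rot a b t) \<in> space (matM m)" by simp
    show ?thesis by measurable
  qed
  show meas: "rotate i a b t \<in> measurable Om Om"
    unfolding rotate_def Om_def
  proof (rule measurable_fun_upd[where J = "{1..k}"])
    show "(\<lambda>\<omega>. ?R (\<omega> i)) \<in> measurable (PiM {1..k} (\<lambda>_. \<mu>)) \<mu>"
      by (rule measurable_compose[OF _ meas_R], rule measurable_component_singleton) (rule assms(1))
  qed (use assms(1) in auto)
  interpret PS: product_prob_space "\<lambda>_. \<mu>" "{1..k}" by standard
  show "distr Om Om (rotate i a b t) = Om"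
  proof (subst (3) Om_def, rule PS.PiM_eqI)
    fix B assume B: "\<And>j. j \<in> {1..k} \<Longrightarrow> B j \<in> sets \<mu>"
    define B' where "B' j = (if j = i then ?R -` B i \<inter> space \<mu> else B j)" for j
    have B': "B' j \<in> sets \<mu>" if "j \<in> {1..k}" for j
      using B that assms(1) measurable_sets[OF meas_R] by (auto simp: B'_def)
    have "rotate i a b t -` Pi\<^sub>E {1..k} B \<inter> space Om = Pi\<^sub>E {1..k} B'"
    proof (intro equalityI subsetI)
      fix \<omega> assume w: "\<omega> \<in> rotate i a b t -` Pi\<^sub>E {1..k} B \<inter> space Om"
      then have sp: "\<omega> \<in> {1..k} \<rightarrow>\<^sub>E space \<mu>" by (simp add: Om_def space_PiM)
      show "\<omega> \<in> Pi\<^sub>E {1..k} B'"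
      proof (rule PiE_I)
        fix j assume j: "j \<in> {1..k}"
        have "rotate i a b t \<omega> j \<in> B j" "\<omega> j \<in> space \<mu>"
          using w PiE_mem[OF _ j] sp by (auto simp del: PiE_iff)
        then show "\<omega> j \<in> B' j" by (auto simp: B'_def rotate_def)
      qed (use sp in \<open>auto simp: PiE_iff extensional_def\<close>)
    next
      fix \<omega> assume w: "\<omega> \<in> Pi\<^sub>E {1..k} B'"
      have "\<omega> j \<in> space \<mu>" if "j \<in> {1..k}" for j
        using PiE_mem[OF w that] sets.sets_into_space[OF B'[OF that]] by (rule set_mp[rotated])
      then have "\<omega> \<in> space Om" using w by (auto simp: Om_def space_PiM PiE_iff)
      moreover have "rotate i a b t \<omega> j \<in> B j" if "j \<in> {1..k}" for j
        using PiE_mem[OF w that] by (auto simp: B'_def rotate_def split: if_splits)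
      moreover have "rotate i a b t \<omega> \<in> extensional {1..k}"
        using w assms(1) by (auto simp: rotate_def extensional_def PiE_iff)
      ultimately show "\<omega> \<in> rotate i a b t -` Pi\<^sub>E {1..k} B \<inter> space Om" by (simp add: PiE_iff)
    qed
    then have "emeasure (distr Om Om (rotate i a b t)) (Pi\<^sub>E {1..k} B) = emeasure Om (Pi\<^sub>E {1..k} B')"
      using B by (subst emeasure_distr[OF meas]) (auto simp: Om_def intro!: sets_PiM_I_finite)
    also have "\<dots> = (\<Prod>j\<in>{1..k}. emeasure \<mu> (B' j))"
      unfolding Om_def by (rule PS.emeasure_PiM) (use B' in auto)
    also have "\<dots> = (\<Prod>j\<in>{1..k}. emeasure \<mu> (B j))"
    proof (intro prod.cong refl)
      fix j assume j: "j \<in> {1..k}"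
      have "emeasure \<mu> (?R -` B i \<inter> space \<mu>) = emeasure (distr \<mu> \<mu> ?R) (B i)"
        by (rule emeasure_distr[symmetric, OF meas_R]) (use B assms in auto)
      then show "emeasure \<mu> (B' j) = emeasure \<mu> (B j)" by (simp add: B'_def R)
    qed
    finally show "emeasure (distr Om Om (rotate i a b t)) (Pi\<^sub>E {1..k} B) = (\<Prod>j\<in>{1..k}. emeasure \<mu> (B j))" .
  qed (auto simp: Om_def)
qed

lemma rotate_0: "i \<in> {1..k} \<Longrightarrow> a < m \<Longrightarrow> b < m \<Longrightarrow> a \<noteq> b \<Longrightarrow> c < m \<Longrightarrow> d < m \<Longrightarrow> A (rotate i a b 0 \<omega>) l c d = A \<omega> l c d"
proof -
  assume "a < m" "b < m" "a \<noteq> b" "c < m" "d < m"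
  then have "mmul m (\<omega> i) (mk_mat m (plane_rot a b 0)) (x, e) = \<omega> i (x, e)" if "x < m" "e < m" for x e
    using that by (simp add: mmul_entry mk_mat_def plane_rot_0 sum_of_bool del: of_bool_eq_iff)
  then show ?thesis
    using \<open>c < m\<close> \<open>d < m\<close> by (auto simp: rotate_def proj_mat_def intro!: sum.cong)
qed

lemma word_entry_cong:
  "(\<And>l c d. c < m \<Longrightarrow> d < m \<Longrightarrow> B l c d = B' l c d) \<Longrightarrow> c < m \<Longrightarrow> d < m \<Longrightarrow> word_entry m B w c d = word_entry m B' w c d"
  by (induction w arbitrary: c) (auto simp: word_entry_Cons intro!: sum.cong)

text \<open>Induction along the word: the product rule for expansions produces exactly the recursion
  \<open>word_deriv_Cons\<close>.\<close>

lemma uniform_expansion_word_entry: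
  assumes "i \<in> {1..k}" "a < m" "b < m" "a \<noteq> b"
  shows "c < m \<Longrightarrow> d < m \<Longrightarrow> uniform_expansion good (\<lambda>t \<omega>. word_entry m (A (rotate i a b t \<omega>)) w c d) (\<lambda>\<omega>. word_deriv m (A \<omega>) i a b w c d)"
proof (induction w arbitrary: c)
  case Nil
  then show ?case by (auto intro!: uniform_expansion_const[of _ _ 1])
next
  case (Cons l w)
  have l: "uniform_expansion good (\<lambda>t \<omega>. A (rotate i a b t \<omega>) l c e) (\<lambda>\<omega>. of_bool (l = i) * comm_entry (A \<omega>) i a b c e)"
    if "e < m" for e
  proof (cases "l = i")
    case True
    then show ?thesis
      using uniform_expansion_proj_mat[OF assms(2-4) Cons.prems(1) that, of good i p] assms(1)
      by (auto simp: rotate_def good_def)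
  next
    case False
    then have "A (rotate i a b t \<omega>) l c e = A \<omega> l c e" for t \<omega>
      by (simp add: proj_mat_def rotate_def)
    then show ?thesis
      using False that Cons.prems by (auto intro!: uniform_expansion_const proj_mat_bound good_or)
  qed
  have "uniform_expansion good (\<lambda>t \<omega>. \<Sum>e<m. A (rotate i a b t \<omega>) l c e * word_entry m (A (rotate i a b t \<omega>)) w e d)
     (\<lambda>\<omega>. \<Sum>e<m. of_bool (l = i) * comm_entry (A \<omega>) i a b c e * word_entry m (A (rotate i a b 0 \<omega>)) w e d
          + A (rotate i a b 0 \<omega>) l c e * word_deriv m (A \<omega>) i a b w e d)"
    by (intro uniform_expansion_sum uniform_expansion_mult l Cons.IH) (use Cons.prems in auto)
  moreover have "(\<Sum>e<m. of_bool (l = i) * comm_entry (A \<omega>) i a b c e * word_entry m (A (rotate i a b 0 \<omega>)) w e d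
          + A (rotate i a b 0 \<omega>) l c e * word_deriv m (A \<omega>) i a b w e d) = word_deriv m (A \<omega>) i a b (l # w) c d" for \<omega>
    using rotate_0[OF assms] word_entry_cong[OF rotate_0[OF assms]] Cons.prems
    by (simp add: word_deriv_Cons[OF assms(2,3)] sum.distrib sum_distrib_left mult.assoc)
  ultimately show ?case by (simp add: word_entry_Cons)
qed

text \<open>The mean of a word entry times traces is unchanged by the rotation, so its first order
  coefficient has mean zero. For a = b the derivative vanishes identically, which later allows
  summation over all a and b.\<close>

lemma moment_rotation:
  assumes "i \<in> {1..k}" "a < m" "b < m" "c < m" "d < m" "finite S"
  shows "(\<integral>\<omega>. word_deriv m (A \<omega>) i a b v c d * (\<Prod>j\<in>S. word_trace m (A \<omega>) (w j)) + word_entry m (A \<omega>) v c d *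
      (\<Sum>j\<in>S. (\<Sum>e<m. word_deriv m (A \<omega>) i a b (w j) e e) * (\<Prod>l\<in>S - {j}. word_trace m (A \<omega>) (w l))) \<partial>Om) = 0"
proof (cases "a = b")
  case True
  then show ?thesis by (simp add: word_deriv_same)
next
  case False
  note ab = assms(1-3) False
  let ?g = "\<lambda>\<omega>. word_entry m (A \<omega>) v c d * (\<Prod>j\<in>S. word_trace m (A \<omega>) (w j))"
  have "uniform_expansion good (\<lambda>t \<omega>. ?g (rotate i a b t \<omega>))
    (\<lambda>\<omega>. word_deriv m (A \<omega>) i a b v c d * (\<Prod>j\<in>S. word_trace m (A (rotate i a b 0 \<omega>)) (w j)) + word_entry m (A (rotate i a b 0 \<omega>)) v c d *
      (\<Sum>j\<in>S. (\<Sum>e<m. word_deriv m (A \<omega>) i a b (w j) e e) * (\<Prod>l\<in>S - {j}. word_trace m (A (rotate i a b 0 \<omega>)) (w l))))"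
    unfolding word_trace_def by (intro uniform_expansion_mult uniform_expansion_prod uniform_expansion_sum uniform_expansion_word_entry[OF ab]) (use assms in auto)
  moreover have "word_trace m (A (rotate i a b 0 \<omega>)) u = word_trace m (A \<omega>) u" for u \<omega>
    unfolding word_trace_def by (intro sum.cong word_entry_cong rotate_0[OF ab]) auto
  moreover have "word_entry m (A (rotate i a b 0 \<omega>)) v c d = word_entry m (A \<omega>) v c d" for \<omega>
    by (intro word_entry_cong rotate_0[OF ab]) (use assms in auto)
  ultimately have "uniform_expansion good (\<lambda>t \<omega>. ?g (rotate i a b t \<omega>))
    (\<lambda>\<omega>. word_deriv m (A \<omega>) i a b v c d * (\<Prod>j\<in>S. word_trace m (A \<omega>) (w j)) + word_entry m (A \<omega>) v c d *
      (\<Sum>j\<in>S. (\<Sum>e<m. word_deriv m (A \<omega>) i a b (w j) e e) * (\<Prod>l\<in>S - {j}. word_trace m (A \<omega>) (w l))))"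
    by simp
  then show ?thesis
  proof (rule P.uniform_expansion_expectation[OF _ AE_good])
    have g [measurable]: "?g \<in> borel_measurable Om" using assms by measurable
    show "(\<lambda>\<omega>. ?g (rotate i a b t \<omega>)) \<in> borel_measurable Om" for t
      by (rule measurable_compose[OF rotate_distr(1)[OF ab] g])
    show "(\<lambda>\<omega>. word_deriv m (A \<omega>) i a b v c d * (\<Prod>j\<in>S. word_trace m (A \<omega>) (w j)) + word_entry m (A \<omega>) v c d *
      (\<Sum>j\<in>S. (\<Sum>e<m. word_deriv m (A \<omega>) i a b (w j) e e) * (\<Prod>l\<in>S - {j}. word_trace m (A \<omega>) (w l)))) \<in> borel_measurable Om"
      using assms by measurable
    have "P.expectation (\<lambda>\<omega>. ?g (rotate i a b t \<omega>)) = P.expectation ?g" for t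
      by (subst (2) rotate_distr(2)[OF ab, of t, symmetric])
         (rule integral_distr[symmetric, OF rotate_distr(1)[OF ab] g])
    then show "P.expectation (\<lambda>\<omega>. ?g (rotate i a b t \<omega>)) = P.expectation (\<lambda>\<omega>. ?g (rotate i a b 0 \<omega>))" for t
      by metis
  qed
qed

end

subsection \<open>The loop equation\<close>

context projection_model begin

text \<open>Bounds are required on the almost sure set \<open>good\<close> only, which suffices for
  integrability. Closure under sums and products then settles the integrability conditions behind
  each linear manipulation.\<close>

definition bounded_obs :: "((nat \<Rightarrow> nat \<times> nat \<Rightarrow> real) \<Rightarrow> real) set" where
  "bounded_obs = {f. f \<in> borel_measurable Om \<and> (\<exists>B. \<forall>\<omega>\<in>good. \<bar>f \<omega>\<bar> \<le> B)}"

lemma bounded_obs_integrable: "f \<in> bounded_obs \<Longrightarrow> integrable Om f"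
proof -
  assume "f \<in> bounded_obs"
  then obtain B where f: "f \<in> borel_measurable Om" and B: "\<And>\<omega>. \<omega> \<in> good \<Longrightarrow> \<bar>f \<omega>\<bar> \<le> B"
    by (auto simp: bounded_obs_def)
  show ?thesis
    by (rule P.integrable_const_bound[OF _ f, of B], use AE_good in eventually_elim) (simp add: B)
qed

lemma bounded_obsI: "f \<in> borel_measurable Om \<Longrightarrow> (\<And>\<omega>. \<omega> \<in> good \<Longrightarrow> \<bar>f \<omega>\<bar> \<le> B) \<Longrightarrow> f \<in> bounded_obs"
  by (auto simp: bounded_obs_def)

lemma bounded_obsE: assumes "f \<in> bounded_obs" obtains B where "f \<in> borel_measurable Om" "B \<ge> 0" "\<And>\<omega>. \<omega> \<in> good \<Longrightarrow> \<bar>f \<omega>\<bar> \<le> B"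
proof -
  obtain B where *: "f \<in> borel_measurable Om" "\<And>\<omega>. \<omega> \<in> good \<Longrightarrow> \<bar>f \<omega>\<bar> \<le> B"
    using assms by (auto simp: bounded_obs_def)
  show ?thesis by (rule that[OF *(1), of "max B 0"]) (use *(2) in \<open>auto intro: max.coboundedI1\<close>)
qed

lemma bounded_obs_const [simp, intro]: "(\<lambda>_. c) \<in> bounded_obs"
  by (rule bounded_obsI[of _ "\<bar>c\<bar>"]) auto

lemma bounded_obs_add [intro]: "f \<in> bounded_obs \<Longrightarrow> g \<in> bounded_obs \<Longrightarrow> (\<lambda>\<omega>. f \<omega> + g \<omega>) \<in> bounded_obs"
  apply (elim bounded_obsE)
  subgoal for B C by (rule bounded_obsI[of _ "B + C"]) (force intro: order_trans[OF abs_triangle_ineq] add_mono)+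
  done

lemma bounded_obs_mult [intro]: "f \<in> bounded_obs \<Longrightarrow> g \<in> bounded_obs \<Longrightarrow> (\<lambda>\<omega>. f \<omega> * g \<omega>) \<in> bounded_obs"
  apply (elim bounded_obsE)
  subgoal for B C by (rule bounded_obsI[of _ "B * C"]) (auto simp: abs_mult intro!: mult_mono)
  done

lemma bounded_obs_diff [intro]: "f \<in> bounded_obs \<Longrightarrow> g \<in> bounded_obs \<Longrightarrow> (\<lambda>\<omega>. f \<omega> - g \<omega>) \<in> bounded_obs"
  using bounded_obs_add[of f "\<lambda>\<omega>. (-1) * g \<omega>"] bounded_obs_mult[of "\<lambda>_. -1" g] by simp

lemma bounded_obs_sum [intro]: "(\<And>x. x \<in> X \<Longrightarrow> f x \<in> bounded_obs) \<Longrightarrow> (\<lambda>\<omega>. \<Sum>x\<in>X. f x \<omega>) \<in> bounded_obs"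
  by (induction X rule: infinite_finite_induct) auto

lemma bounded_obs_prod [intro]: "(\<And>x. x \<in> X \<Longrightarrow> f x \<in> bounded_obs) \<Longrightarrow> (\<lambda>\<omega>. \<Prod>x\<in>X. f x \<omega>) \<in> bounded_obs"
  by (induction X rule: infinite_finite_induct) auto

lemma bounded_obs_word_entry [intro]: "a < m \<Longrightarrow> b < m \<Longrightarrow> (\<lambda>\<omega>. word_entry m (A \<omega>) w a b) \<in> bounded_obs"
  by (rule bounded_obsI[OF _ word_entry_bound_good]) auto

lemma bounded_obs_word_trace [intro]: "(\<lambda>\<omega>. word_trace m (A \<omega>) w) \<in> bounded_obs"
  by (rule bounded_obsI[OF _ word_trace_bound_good]) auto

lemma bounded_obs_word_deriv [intro]: "a < m \<Longrightarrow> b < m \<Longrightarrow> c < m \<Longrightarrow> d < m \<Longrightarrow> (\<lambda>\<omega>. word_deriv m (A \<omega>) i a b w c d) \<in> bounded_obs"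
  unfolding word_deriv_def by (intro bounded_obs_sum bounded_obs_add bounded_obs_diff bounded_obs_mult bounded_obs_word_entry)

definition trace_word :: "nat list \<Rightarrow> (nat \<Rightarrow> nat \<times> nat \<Rightarrow> real) \<Rightarrow> real" where
  "trace_word w \<omega> = word_trace m (A \<omega>) w"

lemma bounded_obs_trace_word [intro]: "trace_word w \<in> bounded_obs"
  using bounded_obs_word_trace[of w] unfolding trace_word_def[abs_def] .

abbreviation word_moment :: "('j \<Rightarrow> nat list) \<Rightarrow> ((nat \<Rightarrow> nat \<times> nat \<Rightarrow> real) \<Rightarrow> real) \<Rightarrow> 'j set \<Rightarrow> real" where
  "word_moment w X S \<equiv> moment Om X (\<lambda>j. trace_word (w j)) S"

abbreviation word_kappa :: "('j \<Rightarrow> nat list) \<Rightarrow> ((nat \<Rightarrow> nat \<times> nat \<Rightarrow> real) \<Rightarrow> real) \<Rightarrow> 'j set \<Rightarrow> real" where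
  "word_kappa w X S \<equiv> kappa Om X (\<lambda>j. trace_word (w j)) S"

lemma word_moment_add: "X \<in> bounded_obs \<Longrightarrow> Y \<in> bounded_obs \<Longrightarrow> word_moment w (\<lambda>\<omega>. X \<omega> + Y \<omega>) S = word_moment w X S + word_moment w Y S"
  and word_moment_diff: "X \<in> bounded_obs \<Longrightarrow> Y \<in> bounded_obs \<Longrightarrow> word_moment w (\<lambda>\<omega>. X \<omega> - Y \<omega>) S = word_moment w X S - word_moment w Y S"
  unfolding moment_def distrib_right left_diff_distrib
  by (intro Bochner_Integration.integral_add Bochner_Integration.integral_diff bounded_obs_integrable bounded_obs_mult bounded_obs_prod bounded_obs_trace_word; assumption)+

lemma word_moment_sum: "(\<And>x. x \<in> B \<Longrightarrow> X x \<in> bounded_obs) \<Longrightarrow> word_moment w (\<lambda>\<omega>. \<Sum>x\<in>B. X x \<omega>) S = (\<Sum>x\<in>B. word_moment w (X x) S)"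
  unfolding moment_def sum_distrib_right
  by (intro Bochner_Integration.integral_sum bounded_obs_integrable bounded_obs_mult bounded_obs_prod bounded_obs_trace_word)

text \<open>\<open>moment_rotation\<close> with c = a and d = b, summed over a and b. The first sum
  cuts v; in the second v swallows the word w_j, whose trace leaves the product.\<close>

lemma moment_loop:
  assumes i: "i \<in> {1..k}" and S: "finite S"
  shows "(\<Sum>t | t < length v \<and> v ! t = i.
        word_moment w (\<lambda>\<omega>. trace_word (take (Suc t) v) \<omega> * trace_word (drop (Suc t) v) \<omega>) S
      - word_moment w (trace_word (take (Suc t) v @ rev (drop (Suc t) v))) S
      - word_moment w (\<lambda>\<omega>. trace_word (take t v) \<omega> * trace_word (drop t v) \<omega>) S
      + word_moment w (trace_word (take t v @ rev (drop t v))) S)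
    + (\<Sum>j\<in>S. \<Sum>t | t < length (w j) \<and> w j ! t = i.
        word_moment w (trace_word (v @ drop (Suc t) (w j) @ take (Suc t) (w j))) (S - {j})
      - word_moment w (trace_word (v @ rev (drop (Suc t) (w j) @ take (Suc t) (w j)))) (S - {j})
      - word_moment w (trace_word (v @ drop t (w j) @ take t (w j))) (S - {j})
      + word_moment w (trace_word (v @ rev (drop t (w j) @ take t (w j)))) (S - {j})) = 0"
proof -
  let ?f = "\<lambda>a b \<omega>. word_deriv m (A \<omega>) i a b v a b * (\<Prod>j\<in>S. trace_word (w j) \<omega>) + word_entry m (A \<omega>) v a b *
      (\<Sum>j\<in>S. (\<Sum>e<m. word_deriv m (A \<omega>) i a b (w j) e e) * (\<Prod>l\<in>S - {j}. trace_word (w l) \<omega>))"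
  let ?D = "\<lambda>\<omega>. \<Sum>t | t < length v \<and> v ! t = i.
      trace_word (take (Suc t) v) \<omega> * trace_word (drop (Suc t) v) \<omega>
    - trace_word (take (Suc t) v @ rev (drop (Suc t) v)) \<omega>
    - trace_word (take t v) \<omega> * trace_word (drop t v) \<omega>
    + trace_word (take t v @ rev (drop t v)) \<omega>"
  let ?E = "\<lambda>j \<omega>. \<Sum>t | t < length (w j) \<and> w j ! t = i.
        trace_word (v @ drop (Suc t) (w j) @ take (Suc t) (w j)) \<omega>
      - trace_word (v @ rev (drop (Suc t) (w j) @ take (Suc t) (w j))) \<omega>
      - trace_word (v @ drop t (w j) @ take t (w j)) \<omega>
      + trace_word (v @ rev (drop t (w j) @ take t (w j))) \<omega>"
  have DE: "(\<Sum>a<m. \<Sum>b<m. ?f a b \<omega>) = ?D \<omega> * (\<Prod>j\<in>S. trace_word (w j) \<omega>) + (\<Sum>j\<in>S. ?E j \<omega> * (\<Prod>l\<in>S - {j}. trace_word (w l) \<omega>))" for \<omega>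
  proof -
    have "(\<Sum>a<m. \<Sum>b<m. word_entry m (A \<omega>) v a b * (\<Sum>j\<in>S. (\<Sum>e<m. word_deriv m (A \<omega>) i a b (w j) e e) * (\<Prod>l\<in>S - {j}. trace_word (w l) \<omega>)))
       = (\<Sum>a<m. \<Sum>b<m. \<Sum>j\<in>S. (word_entry m (A \<omega>) v a b * (\<Sum>e<m. word_deriv m (A \<omega>) i a b (w j) e e)) * (\<Prod>l\<in>S - {j}. trace_word (w l) \<omega>))"
      by (intro sum.cong refl) (subst sum_distrib_left, simp only: mult.assoc)
    also have "\<dots> = (\<Sum>j\<in>S. \<Sum>a<m. \<Sum>b<m. (word_entry m (A \<omega>) v a b * (\<Sum>e<m. word_deriv m (A \<omega>) i a b (w j) e e)) * (\<Prod>l\<in>S - {j}. trace_word (w l) \<omega>))"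
      by (subst (2) sum.swap, subst (1) sum.swap) rule
    also have "\<dots> = (\<Sum>j\<in>S. ?E j \<omega> * (\<Prod>l\<in>S - {j}. trace_word (w l) \<omega>))"
      unfolding sum_distrib_right[symmetric] sum_word_deriv_trace[of "A \<omega>", OF proj_mat_sym] trace_word_def ..
    finally have 2: "(\<Sum>a<m. \<Sum>b<m. word_entry m (A \<omega>) v a b * (\<Sum>j\<in>S. (\<Sum>e<m. word_deriv m (A \<omega>) i a b (w j) e e) * (\<Prod>l\<in>S - {j}. trace_word (w l) \<omega>)))
       = (\<Sum>j\<in>S. ?E j \<omega> * (\<Prod>l\<in>S - {j}. trace_word (w l) \<omega>))" .
    have 1: "(\<Sum>a<m. \<Sum>b<m. word_deriv m (A \<omega>) i a b v a b * (\<Prod>j\<in>S. trace_word (w j) \<omega>)) = ?D \<omega> * (\<Prod>j\<in>S. trace_word (w j) \<omega>)"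
      unfolding sum_distrib_right[symmetric] sum_word_deriv_diag[of "A \<omega>", OF proj_mat_sym] trace_word_def ..
    show ?thesis unfolding sum.distrib 1 2 ..
  qed
  have f_bm: "?f a b \<in> bounded_obs" if "a < m" "b < m" for a b
    using that by (intro bounded_obs_add bounded_obs_mult bounded_obs_prod bounded_obs_sum bounded_obs_trace_word bounded_obs_word_deriv bounded_obs_word_entry) auto
  have "(\<integral>\<omega>. (\<Sum>a<m. \<Sum>b<m. ?f a b \<omega>) \<partial>Om) = (\<Sum>a<m. \<Sum>b<m. \<integral>\<omega>. ?f a b \<omega> \<partial>Om)"
  proof -
    have "(\<integral>\<omega>. (\<Sum>a<m. \<Sum>b<m. ?f a b \<omega>) \<partial>Om) = (\<Sum>a<m. \<integral>\<omega>. (\<Sum>b<m. ?f a b \<omega>) \<partial>Om)"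
      by (rule Bochner_Integration.integral_sum) (auto intro!: bounded_obs_integrable bounded_obs_sum f_bm)
    also have "\<dots> = (\<Sum>a<m. \<Sum>b<m. \<integral>\<omega>. ?f a b \<omega> \<partial>Om)"
      by (intro sum.cong refl Bochner_Integration.integral_sum) (auto intro!: bounded_obs_integrable f_bm)
    finally show ?thesis .
  qed
  also have "\<dots> = 0"
    using moment_rotation[OF i _ _ _ _ S] unfolding trace_word_def by simp
  finally have "(\<integral>\<omega>. ?D \<omega> * (\<Prod>j\<in>S. trace_word (w j) \<omega>) + (\<Sum>j\<in>S. ?E j \<omega> * (\<Prod>l\<in>S - {j}. trace_word (w l) \<omega>)) \<partial>Om) = 0"
    unfolding DE .
  moreover have "(\<integral>\<omega>. ?D \<omega> * (\<Prod>j\<in>S. trace_word (w j) \<omega>) + (\<Sum>j\<in>S. ?E j \<omega> * (\<Prod>l\<in>S - {j}. trace_word (w l) \<omega>)) \<partial>Om) =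
     word_moment w ?D S + (\<Sum>j\<in>S. word_moment w (?E j) (S - {j}))"
    unfolding moment_def
    by (subst Bochner_Integration.integral_add Bochner_Integration.integral_sum;
       (intro bounded_obs_integrable bounded_obs_add bounded_obs_diff bounded_obs_mult bounded_obs_prod bounded_obs_sum bounded_obs_trace_word)?)+ simp
  moreover have "word_moment w ?D S = (\<Sum>t | t < length v \<and> v ! t = i.
        word_moment w (\<lambda>\<omega>. trace_word (take (Suc t) v) \<omega> * trace_word (drop (Suc t) v) \<omega>) S
      - word_moment w (trace_word (take (Suc t) v @ rev (drop (Suc t) v))) S
      - word_moment w (\<lambda>\<omega>. trace_word (take t v) \<omega> * trace_word (drop t v) \<omega>) S
      + word_moment w (trace_word (take t v @ rev (drop t v))) S)"
    by (subst word_moment_sum) (auto intro!: sum.cong simp: word_moment_add word_moment_diff bounded_obs_add bounded_obs_diff bounded_obs_mult bounded_obs_trace_word)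
  moreover have "word_moment w (?E j) (S - {j}) = (\<Sum>t | t < length (w j) \<and> w j ! t = i.
        word_moment w (trace_word (v @ drop (Suc t) (w j) @ take (Suc t) (w j))) (S - {j})
      - word_moment w (trace_word (v @ rev (drop (Suc t) (w j) @ take (Suc t) (w j)))) (S - {j})
      - word_moment w (trace_word (v @ drop t (w j) @ take t (w j))) (S - {j})
      + word_moment w (trace_word (v @ rev (drop t (w j) @ take t (w j)))) (S - {j}))" for j
    by (subst word_moment_sum) (auto intro!: sum.cong simp: word_moment_add word_moment_diff bounded_obs_add bounded_obs_diff bounded_obs_mult bounded_obs_trace_word)
  ultimately show ?thesis by simp
qed

text \<open>\<open>moment_loop\<close> holds on every subset of S, so both sides can be divided by
  the moment function of the traces; the merge terms are shifts and stay shifts.\<close>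

lemma kappa_loop:
  fixes w :: "'j \<Rightarrow> nat list"
  assumes i: "i \<in> {1..k}" and S: "finite S"
  shows "(\<Sum>t | t < length v \<and> v ! t = i.
        word_kappa w (\<lambda>\<omega>. trace_word (take (Suc t) v) \<omega> * trace_word (drop (Suc t) v) \<omega>) S
      - word_kappa w (trace_word (take (Suc t) v @ rev (drop (Suc t) v))) S
      - word_kappa w (\<lambda>\<omega>. trace_word (take t v) \<omega> * trace_word (drop t v) \<omega>) S
      + word_kappa w (trace_word (take t v @ rev (drop t v))) S)
    + (\<Sum>j\<in>S. \<Sum>t | t < length (w j) \<and> w j ! t = i.
        word_kappa w (trace_word (v @ drop (Suc t) (w j) @ take (Suc t) (w j))) (S - {j})
      - word_kappa w (trace_word (v @ rev (drop (Suc t) (w j) @ take (Suc t) (w j)))) (S - {j})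
      - word_kappa w (trace_word (v @ drop t (w j) @ take t (w j))) (S - {j})
      + word_kappa w (trace_word (v @ rev (drop t (w j) @ take t (w j)))) (S - {j})) = 0"
proof -
  let ?M = "word_moment w (\<lambda>_. 1)"
  let ?D = "\<lambda>I. \<Sum>t | t < length v \<and> v ! t = i.
        word_moment w (\<lambda>\<omega>. trace_word (take (Suc t) v) \<omega> * trace_word (drop (Suc t) v) \<omega>) I
      - word_moment w (trace_word (take (Suc t) v @ rev (drop (Suc t) v))) I
      - word_moment w (\<lambda>\<omega>. trace_word (take t v) \<omega> * trace_word (drop t v) \<omega>) I
      + word_moment w (trace_word (take t v @ rev (drop t v))) I"
  let ?E = "\<lambda>j I. \<Sum>t | t < length (w j) \<and> w j ! t = i.
        word_moment w (trace_word (v @ drop (Suc t) (w j) @ take (Suc t) (w j))) I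
      - word_moment w (trace_word (v @ rev (drop (Suc t) (w j) @ take (Suc t) (w j)))) I
      - word_moment w (trace_word (v @ drop t (w j) @ take t (w j))) I
      + word_moment w (trace_word (v @ rev (drop t (w j) @ take t (w j)))) I"
  have M1: "?M {} = 1" by simp
  \<comment> \<open>Merge terms with j outside I are set to 0, so that the sum runs over the fixed
    set S and is one combination of set functions.\<close>
  have zero: "?D I + (\<Sum>j\<in>S. if j \<in> I then ?E j (I - {j}) else 0) = 0 * ?M I" if I: "I \<subseteq> S" for I
  proof -
    have "(\<Sum>j\<in>S. if j \<in> I then ?E j (I - {j}) else 0) = (\<Sum>j\<in>I. ?E j (I - {j}))"
      using I S by (simp add: sum.If_cases Int_absorb1)
    then show ?thesis using moment_loop[OF i finite_subset[OF I S], of v w] by simp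
  qed
  have "0 = deconv ?M (\<lambda>I. 0 * ?M I) S" using deconv_const[where M = ?M, OF M1 S, of 0] by simp
  also have "\<dots> = deconv ?M (\<lambda>I. ?D I + (\<Sum>j\<in>S. if j \<in> I then ?E j (I - {j}) else 0)) S"
    by (rule deconv_cong[OF refl]) (simp only: zero)
  also have "\<dots> = deconv ?M ?D S + (\<Sum>j\<in>S. deconv ?M (\<lambda>I. if j \<in> I then ?E j (I - {j}) else 0) S)"
    by (simp only: deconv_add[where M = ?M, OF M1 S] deconv_sum1[where M = ?M, OF M1 S])
  also have "(\<Sum>j\<in>S. deconv ?M (\<lambda>I. if j \<in> I then ?E j (I - {j}) else 0) S) = (\<Sum>j\<in>S. deconv ?M (?E j) (S - {j}))"
    by (intro sum.cong refl deconv_shift[where M = ?M, OF M1 S])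
  finally show ?thesis
    unfolding kappa_def
    by (simp only: deconv_add[where M = ?M, OF M1] deconv_diff[where M = ?M, OF M1] deconv_sum1[where M = ?M, OF M1] S finite_Diff)
qed

end

subsection \<open>Orders of cumulants\<close>

context projection_model begin

lemma word_kappa_cong_good:
  assumes "\<And>\<omega>. \<omega> \<in> good \<Longrightarrow> X \<omega> = Y \<omega>" "X \<in> bounded_obs" "Y \<in> bounded_obs"
  shows "word_kappa w X S = word_kappa w Y S"
proof (rule P.kappa_cong_AE)
  show "AE \<omega> in Om. X \<omega> = Y \<omega>" using AE_good by eventually_elim (rule assms(1))
qed (use assms(2,3) bounded_obs_trace_word in \<open>auto simp: bounded_obs_def\<close>)

lemma word_kappa_single:
  assumes "finite S"
  shows "word_kappa w (trace_word [i]) S = (if S = {} then real (min (p i) m) else 0)"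
proof -
  have "word_kappa w (trace_word [i]) S = word_kappa w (\<lambda>_. real (min (p i) m)) S"
    by (rule word_kappa_cong_good) (auto simp: trace_word_def word_trace_single_proj_mat good_or)
  then show ?thesis using P.kappa_const[OF assms] by simp
qed

lemma word_kappa_butlast: "word_kappa w (trace_word (i # u @ [i])) S = word_kappa w (trace_word (i # u)) S"
  by (rule word_kappa_cong_good) (auto simp: trace_word_def intro!: word_trace_butlast proj_mat_idem good_or)

lemma word_kappa_outside:
  assumes "finite S" "i \<notin> {1..k}"
  shows "word_kappa w (trace_word (i # u)) S = 0"
proof -
  have "trace_word (i # u) = (\<lambda>_. 0)"
    using p_outside[OF assms(2)] by (simp add: trace_word_def fun_eq_iff word_trace_def word_entry_Cons proj_mat_def)
  then show ?thesis using P.kappa_const[OF assms(1), of 0] by simp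
qed

lemma word_kappa_mult:
  assumes "finite S" "y \<notin> S"
  shows "word_kappa w (\<lambda>\<omega>. trace_word u \<omega> * trace_word v \<omega>) S =
    word_kappa (w(y := v)) (trace_word u) (insert y S) + (\<Sum>I\<in>Pow S. word_kappa w (trace_word u) I * word_kappa w (trace_word v) (S - I))"
proof -
  have "(\<lambda>j. trace_word ((w(y := v)) j)) = (\<lambda>j. trace_word (w j))(y := trace_word v)" by auto
  then show ?thesis using P.kappa_mult[OF assms, of "trace_word u" "trace_word v" "\<lambda>j. trace_word (w j)"] by simp
qed

text \<open>The cut at position 0 provides the left side, since it contains Tr [] Tr v = m Tr v with
  a minus sign. Its other product, Tr [i] Tr R, has a deterministic first factor.\<close>

lemma word_kappa_recursion:
  assumes i: "i \<in> {1..k}" and S: "finite S" and v: "v = i # R"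
  shows "real m * word_kappa w (trace_word v) S = real (min (p i) m) * word_kappa w (trace_word R) S - word_kappa w (trace_word (i # rev R)) S + word_kappa w (trace_word (rev v)) S
    + (\<Sum>t | 0 < t \<and> t < length v \<and> v ! t = i.
        word_kappa w (\<lambda>\<omega>. trace_word (take (Suc t) v) \<omega> * trace_word (drop (Suc t) v) \<omega>) S
      - word_kappa w (trace_word (take (Suc t) v @ rev (drop (Suc t) v))) S
      - word_kappa w (\<lambda>\<omega>. trace_word (take t v) \<omega> * trace_word (drop t v) \<omega>) S
      + word_kappa w (trace_word (take t v @ rev (drop t v))) S)
    + (\<Sum>j\<in>S. \<Sum>t | t < length (w j) \<and> w j ! t = i.
        word_kappa w (trace_word (v @ drop (Suc t) (w j) @ take (Suc t) (w j))) (S - {j})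
      - word_kappa w (trace_word (v @ rev (drop (Suc t) (w j) @ take (Suc t) (w j)))) (S - {j})
      - word_kappa w (trace_word (v @ drop t (w j) @ take t (w j))) (S - {j})
      + word_kappa w (trace_word (v @ rev (drop t (w j) @ take t (w j)))) (S - {j}))"
proof -
  have T: "{t. t < length v \<and> v ! t = i} = insert 0 {t. 0 < t \<and> t < length v \<and> v ! t = i}"
    using v by auto
  have 1: "word_kappa w (\<lambda>\<omega>. trace_word [i] \<omega> * trace_word R \<omega>) S = real (min (p i) m) * word_kappa w (trace_word R) S"
  proof -
    have "word_kappa w (\<lambda>\<omega>. trace_word [i] \<omega> * trace_word R \<omega>) S = word_kappa w (\<lambda>\<omega>. real (min (p i) m) * trace_word R \<omega>) S"
      by (rule word_kappa_cong_good) (auto simp: trace_word_def[of "[i]"] word_trace_single_proj_mat good_or)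
    then show ?thesis using P.kappa_cmult[OF S] by simp
  qed
  have 2: "word_kappa w (\<lambda>\<omega>. trace_word [] \<omega> * trace_word v \<omega>) S = real m * word_kappa w (trace_word v) S"
    using P.kappa_cmult[OF S, of "real m" "trace_word v"] by (simp add: trace_word_def[of "[]"])
  have t: "take (Suc 0) v = [i]" "drop (Suc 0) v = R" using v by auto
  show ?thesis
    using kappa_loop[OF i S, of v w] unfolding T
    by (simp add: t 1 2)
qed

lemma expectation_bound:
  assumes "X \<in> bounded_obs" "\<And>\<omega>. \<omega> \<in> good \<Longrightarrow> \<bar>X \<omega>\<bar> \<le> B"
  shows "\<bar>P.expectation X\<bar> \<le> B"
proof -
  have "\<bar>P.expectation X\<bar> \<le> P.expectation (\<lambda>\<omega>. \<bar>X \<omega>\<bar>)" by (rule integral_abs_bound)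
  also have "\<dots> \<le> P.expectation (\<lambda>_. B)"
    by (rule integral_mono_AE) (use assms bounded_obs_integrable AE_good in \<open>auto elim: eventually_mono\<close>)
  finally show ?thesis by (simp add: P.prob_space)
qed

lemma prod_trace_word_bound:
  "\<omega> \<in> good \<Longrightarrow> \<bar>\<Prod>j\<in>S. trace_word (w j) \<omega>\<bar> \<le> real m ^ (\<Sum>j\<in>S. 2 * length (w j) + 1)"
  unfolding abs_prod power_sum trace_word_def by (intro prod_mono conjI abs_ge_zero word_trace_bound_good)

lemma word_moment_1_bound: "\<bar>word_moment w (\<lambda>_. 1) S\<bar> \<le> real m ^ (\<Sum>j\<in>S. 2 * length (w j) + 1)"
  unfolding moment_def by (rule expectation_bound) (use prod_trace_word_bound in auto)

lemma word_moment_bound: "\<bar>word_moment w (trace_word v) S\<bar> \<le> real m ^ (2 * length v + 1 + (\<Sum>j\<in>S. 2 * length (w j) + 1))"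
  unfolding moment_def power_add[of _ "2 * length v + 1"]
proof (rule expectation_bound)
  fix \<omega> assume g: "\<omega> \<in> good"
  show "\<bar>trace_word v \<omega> * (\<Prod>j\<in>S. trace_word (w j) \<omega>)\<bar> \<le> real m ^ (2 * length v + 1) * real m ^ (\<Sum>j\<in>S. 2 * length (w j) + 1)"
    unfolding abs_mult
    by (intro mult_mono prod_trace_word_bound g) (use word_trace_bound_good[OF g, of v] in \<open>auto simp: trace_word_def\<close>)
qed (intro bounded_obs_mult bounded_obs_prod bounded_obs_trace_word)

end

text \<open>Powers of the dimension m = n - 1 with integer exponents, as cumulants may have negative
  order. For n \<le> 1 the base is 0, so the rules for exponents are used only for n \<ge>
  2.\<close>

definition order_le :: "int \<Rightarrow> (nat \<Rightarrow> real) \<Rightarrow> bool" where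
  "order_le z f \<longleftrightarrow> f \<in> O(\<lambda>n. real (n - 1) powi z)"

section \<open>Arithmetic of orders in powers of the dimension\<close>

lemma ev_ge_2: "eventually (\<lambda>n. real (n - 1) \<ge> 1) sequentially"
  using eventually_ge_at_top[of 2] by eventually_elim auto

lemma order_le_add: "order_le z f \<Longrightarrow> order_le z g \<Longrightarrow> order_le z (\<lambda>n. f n + g n)"
  unfolding order_le_def by (rule sum_in_bigo)

lemma order_le_diff: "order_le z f \<Longrightarrow> order_le z g \<Longrightarrow> order_le z (\<lambda>n. f n - g n)"
  unfolding order_le_def by (rule sum_in_bigo)

lemma order_le_sum: "(\<And>x. x \<in> X \<Longrightarrow> order_le z (f x)) \<Longrightarrow> order_le z (\<lambda>n. \<Sum>x\<in>X. f x n)"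
  unfolding order_le_def by (rule big_sum_in_bigo)

lemma order_le_mult: 
  assumes "order_le y f" "order_le z g"
  shows "order_le (y + z) (\<lambda>n. f n * g n)"
proof -
  have "(\<lambda>n. f n * g n) \<in> O(\<lambda>n. real (n - 1) powi y * real (n - 1) powi z)"
    using assms unfolding order_le_def by (rule landau_o.big.mult)
  also have "(\<lambda>n. real (n - 1) powi y * real (n - 1) powi z) \<in> O(\<lambda>n. real (n - 1) powi (y + z))"
  proof (rule bigoI[of _ 1])
    show "\<forall>\<^sub>F n in sequentially. norm (real (n - 1) powi y * real (n - 1) powi z) \<le> 1 * norm (real (n - 1) powi (y + z))"
      using ev_ge_2 by eventually_elim (simp add: power_int_add)
  qed
  finally show ?thesis by (simp add: order_le_def)
qed

lemma order_le_bound: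
  assumes "\<And>n. \<bar>f n\<bar> \<le> C * real (n - 1) powi z"
  shows "order_le z f"
  unfolding order_le_def by (rule bigoI[of _ C]) (use assms in \<open>auto simp: abs_of_nonneg\<close>)

lemma order_le_mono:
  assumes "order_le y f" "y \<le> z"
  shows "order_le z f"
proof -
  have "(\<lambda>n. real (n - 1) powi y) \<in> O(\<lambda>n. real (n - 1) powi z)"
  proof (rule bigoI[of _ 1])
    show "\<forall>\<^sub>F n in sequentially. norm (real (n - 1) powi y) \<le> 1 * norm (real (n - 1) powi z)"
      using ev_ge_2 by eventually_elim (use assms(2) in \<open>auto intro: power_int_increasing\<close>)
  qed
  with assms(1) show ?thesis unfolding order_le_def by (rule landau_o.big_trans)
qed

lemma order_le_cong_ev:
  "order_le z f \<Longrightarrow> (\<And>n. n \<ge> 2 \<Longrightarrow> f n = g n) \<Longrightarrow> order_le z g"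
  unfolding order_le_def
  by (subst landau_o.big.in_cong[of g f]) (auto intro: eventually_mono[OF eventually_ge_at_top[of 2]])

lemma order_le_div:
  assumes "order_le (z + 1) (\<lambda>n. real (n - 1) * f n)"
  shows "order_le z f"
proof -
  have "order_le (-1) (\<lambda>n. real (n - 1) powi (-1))" by (rule order_le_bound[of _ 1]) auto
  from order_le_mult[OF this assms] show ?thesis
    by (auto intro: order_le_cong_ev simp: power_int_minus field_simps)
qed

text \<open>Orders involve all n at once, so the model is assumed for every n and its lemmas are
  instantiated explicitly; \<open>transfer\<close> then supplies names that are uniform in
  n.\<close>

locale haar_family =
  fixes k :: nat and pp :: "nat \<Rightarrow> nat \<Rightarrow> nat" and H :: "nat \<Rightarrow> (nat \<times> nat \<Rightarrow> real) measure"
  assumes projection_model: "projection_model (n - 1) (H n) k (pp n)"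
begin

definition OM :: "nat \<Rightarrow> (nat \<Rightarrow> nat \<times> nat \<Rightarrow> real) measure" where
  "OM n = PiM {1..k} (\<lambda>_. H n)"

definition tr :: "nat \<Rightarrow> nat list \<Rightarrow> (nat \<Rightarrow> nat \<times> nat \<Rightarrow> real) \<Rightarrow> real" where
  "tr n v \<omega> = word_trace (n - 1) (proj_mat (n - 1) (pp n) \<omega>) v"

definition obs_kappa :: "nat \<Rightarrow> ((nat \<Rightarrow> nat \<times> nat \<Rightarrow> real) \<Rightarrow> real) \<Rightarrow> (nat \<Rightarrow> nat list) \<Rightarrow> nat set \<Rightarrow> real" where
  "obs_kappa n X w S = kappa (OM n) X (\<lambda>j. tr n (w j)) S"

abbreviation "word_kappa_n n v w S \<equiv> obs_kappa n (tr n v) w S"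

abbreviation "total_length (v :: nat list) (w :: nat \<Rightarrow> nat list) S \<equiv> length v + (\<Sum>j\<in>S. length (w j))"

lemma transfer:
  "projection_model.Om (H n) k = OM n" "projection_model.trace_word (n - 1) (pp n) = tr n"
  using projection_model.Om_def[OF projection_model[of n]] projection_model.trace_word_def[OF projection_model[of n]]
  by (auto simp: OM_def tr_def fun_eq_iff)

text \<open>The exponents in the moment bounds add up over disjoint index sets, hence the recursion
  defining the quotient preserves them.\<close>

lemma a_priori:
  assumes "finite S"
  shows "order_le (int (2 * length v + 1 + (\<Sum>j\<in>S. 2 * length (w j) + 1))) (\<lambda>n. word_kappa_n n v w S)"
  using assms
proof (induction S rule: finite_psubset_induct)
  case (psubset S)
  let ?N = "\<lambda>S. (\<Sum>j\<in>S. 2 * length (w j) + 1)"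
  have word_moment: "order_le (int (2 * length v + 1 + ?N I)) (\<lambda>n. moment (OM n) (tr n v) (\<lambda>j. tr n (w j)) I)" for I
    by (rule order_le_bound[of _ 1])
       (use projection_model.word_moment_bound[OF projection_model, where w = w and v = v and S = I, unfolded transfer] in \<open>simp add: power_int_of_nat del: of_nat_add of_nat_Suc\<close>)
  have mo1: "order_le (int (?N I)) (\<lambda>n. moment (OM n) (\<lambda>_. 1) (\<lambda>j. tr n (w j)) I)" for I
    by (rule order_le_bound[of _ 1])
       (use projection_model.word_moment_1_bound[OF projection_model, where w = w and S = I, unfolded transfer] in \<open>simp add: power_int_of_nat del: of_nat_add of_nat_Suc of_nat_sum\<close>)
  have eq: "word_kappa_n n v w S = moment (OM n) (tr n v) (\<lambda>j. tr n (w j)) S -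
    (\<Sum>I\<in>{I. I \<subset> S}. word_kappa_n n v w I * moment (OM n) (\<lambda>_. 1) (\<lambda>j. tr n (w j)) (S - I))" for n
    unfolding obs_kappa_def kappa_def by (subst deconv.simps) (use psubset.hyps in simp)
  show ?case unfolding eq
  proof (intro order_le_diff order_le_sum word_moment)
    fix I assume I: "I \<in> {I. I \<subset> S}"
    have "?N S = ?N I + ?N (S - I)"
      using I psubset.hyps by (subst sum.subset_diff[of I S]) auto
    then have e: "int (2 * length v + 1 + ?N S) = int (2 * length v + 1 + ?N I) + int (?N (S - I))"
      by (simp only: of_nat_add add.assoc)
    show "order_le (int (2 * length v + 1 + ?N S)) (\<lambda>n. word_kappa_n n v w I * moment (OM n) (\<lambda>_. 1) (\<lambda>j. tr n (w j)) (S - I))"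
      unfolding e by (rule order_le_mult[OF psubset.IH mo1]) (use I in simp)
  qed
qed

lemma order_le_min: "order_le 1 (\<lambda>n. real (min (pp n i) (n - 1)))"
  by (rule order_le_bound[of _ 1]) auto

text \<open>One round of the bootstrap: with total length at most L, an error of s + 1 powers of n in
  the expected order 1 - card S is improved to s powers.\<close>
lemma bootstrap_step:
  fixes s :: nat
  assumes shorter: "\<And>v w S. finite S \<Longrightarrow> v \<noteq> [] \<Longrightarrow> (\<forall>j\<in>S. w j \<noteq> []) \<Longrightarrow> total_length v w S < L \<Longrightarrow>
      order_le (1 - int (card S)) (\<lambda>n. word_kappa_n n v w S)"
    and prev: "\<And>v w S. finite S \<Longrightarrow> v \<noteq> [] \<Longrightarrow> (\<forall>j\<in>S. w j \<noteq> []) \<Longrightarrow> total_length v w S \<le> L \<Longrightarrow>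
      order_le (2 - int (card S) + int s) (\<lambda>n. word_kappa_n n v w S)"
    and S: "finite S"
  shows "v \<noteq> [] \<Longrightarrow> (\<forall>j\<in>S. w j \<noteq> []) \<Longrightarrow> total_length v w S \<le> L \<Longrightarrow>
      order_le (1 - int (card S) + int s) (\<lambda>n. word_kappa_n n v w S)"
  using S
proof (induction S arbitrary: v rule: finite_psubset_induct)
  case (psubset S)
  note fin = psubset.hyps
  have w: "\<forall>j\<in>I. w j \<noteq> []" if "I \<subseteq> S" for I using psubset.prems that by auto
  obtain i R where v: "v = i # R" using psubset.prems by (cases v) auto
  \<comment> \<open>A last letter equal to the first has to be removed before the loop equation is
    used: the cut behind it would put Tr v Tr [] = m Tr v on the right and cancel the term to be
    estimated.\<close>
  consider "i \<notin> {1..k}" | "R = []" | "R \<noteq> []" "last R = i" | "i \<in> {1..k}" "R \<noteq> []" "last R \<noteq> i" by blast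
  then show ?case
  proof cases
    case 1
    then have "word_kappa_n n v w S = 0" for n
      using projection_model.word_kappa_outside[OF projection_model fin, where i = i and w = w and u = R, unfolded transfer] by (simp add: obs_kappa_def v)
    then show ?thesis by (simp add: order_le_def)
  next
    case 2
    then have "word_kappa_n n v w S = (if S = {} then real (min (pp n i) (n - 1)) else 0)" for n
      using projection_model.word_kappa_single[OF projection_model fin, where w = w and i = i, unfolded transfer] by (simp add: obs_kappa_def v)
    then have eq: "(\<lambda>n. word_kappa_n n v w S) = (\<lambda>n. if S = {} then real (min (pp n i) (n - 1)) else 0)" ..
    show ?thesis
    proof (cases "S = {}")
      case True
      then show ?thesis unfolding eq using order_le_mono[OF order_le_min] by simp
    next
      case False
      then show ?thesis unfolding eq by (simp add: order_le_def)
    qed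
  next
    case 3
    then obtain u where u: "R = u @ [i]" by (metis append_butlast_last_id)
    have "word_kappa_n n v w S = word_kappa_n n (i # u) w S" for n
      using projection_model.word_kappa_butlast[OF projection_model, where w = w and i = i and u = u and S = S, unfolded transfer] by (simp add: obs_kappa_def v u)
    moreover have "order_le (1 - int (card S)) (\<lambda>n. word_kappa_n n (i # u) w S)"
      by (rule shorter) (use psubset.prems fin v u in auto)
    ultimately show ?thesis by (auto intro: order_le_mono)
  next
    case 4
    obtain y where y: "y \<notin> S" using fin ex_new_if_finite[OF infinite_UNIV_nat] by blast
    let ?z = "2 - int (card S) + int s"
    have same: "order_le ?z (\<lambda>n. word_kappa_n n u w S)" if "length u = length v" for u
      by (rule prev) (use that psubset.prems fin in auto)
    \<comment> \<open>The cumulant with u' as an additional argument has unchanged total length, but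
      the extra argument lets \<open>prev\<close> leave one power to spare. In the sum over I both
      words are shorter than v, so \<open>shorter\<close> applies and the two orders add up to 2 -
      card S.\<close>
    have prd: "order_le ?z (\<lambda>n. obs_kappa n (\<lambda>\<omega>. tr n u \<omega> * tr n u' \<omega>) w S)"
      if u: "u \<noteq> []" "u' \<noteq> []" "length u + length u' = length v" for u u'
    proof -
      have eq: "obs_kappa n (\<lambda>\<omega>. tr n u \<omega> * tr n u' \<omega>) w S = word_kappa_n n u (w(y := u')) (insert y S) +
          (\<Sum>I\<in>Pow S. word_kappa_n n u w I * word_kappa_n n u' w (S - I))" for n
        using projection_model.word_kappa_mult[OF projection_model fin y, where w = w and u = u and v = u', unfolded transfer] by (simp add: obs_kappa_def)
      have upd: "(\<Sum>j\<in>S. length ((w(y := u')) j)) = (\<Sum>j\<in>S. length (w j))"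
        using y by (intro sum.cong) auto
      have "order_le (2 - int (card (insert y S)) + int s) (\<lambda>n. word_kappa_n n u (w(y := u')) (insert y S))"
      proof (rule prev)
        show "\<forall>j\<in>insert y S. (w(y := u')) j \<noteq> []" using u psubset.prems by simp
        show "total_length u (w(y := u')) (insert y S) \<le> L"
          unfolding sum.insert[OF fin y] upd using u psubset.prems by simp
      qed (use u fin in auto)
      then have "order_le ?z (\<lambda>n. word_kappa_n n u (w(y := u')) (insert y S))"
        by (rule order_le_mono) (use fin y in simp)
      moreover have "order_le ?z (\<lambda>n. word_kappa_n n u w I * word_kappa_n n u' w (S - I))" if I: "I \<in> Pow S" for I
      proof -
        have IS: "I \<subseteq> S" "finite I" using I fin finite_subset by auto
        have pos: "length u < length v" "length u' < length v" using u(3)[symmetric] u(1,2) by simp_all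
        have le: "(\<Sum>j\<in>J. length (w j)) \<le> (\<Sum>j\<in>S. length (w j))" if "J \<subseteq> S" for J
          using that fin by (intro sum_mono2) auto
        have "total_length u w I < L" "total_length u' w (S - I) < L"
          using pos le[OF IS(1)] le[OF Diff_subset, of I] psubset.prems(3) by linarith+
        then have 1: "order_le (1 - int (card I)) (\<lambda>n. word_kappa_n n u w I)"
          and 2: "order_le (1 - int (card (S - I))) (\<lambda>n. word_kappa_n n u' w (S - I))"
          using IS fin u w[OF IS(1)] w[of "S - I"] by (auto intro!: shorter)
        have "int (card S) = int (card I) + int (card (S - I))"
          using IS fin card_mono[OF fin IS(1)] by (simp add: card_Diff_subset)
        then show ?thesis
          using order_le_mult[OF 1 2] by (auto intro: order_le_mono)
      qed
      ultimately show ?thesis unfolding eq by (intro order_le_add order_le_sum)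
    qed
    \<comment> \<open>The total length is unchanged but j has left S, so the induction on S applies
      within the same round; having one argument less costs the one power that the division by m
      regains.\<close>
    have merge: "order_le ?z (\<lambda>n. word_kappa_n n u w (S - {j}))" if j: "j \<in> S" and u: "length u = length v + length (w j)" for j u
    proof -
      have "total_length u w (S - {j}) = total_length v w S"
        using u sum.remove[OF fin j, of "\<lambda>j. length (w j)"] by simp
      moreover have "u \<noteq> []" using u v by auto
      ultimately have "order_le (1 - int (card (S - {j})) + int s) (\<lambda>n. word_kappa_n n u w (S - {j}))"
        using j psubset.prems by (intro psubset.IH) auto
      then show ?thesis
        by (rule order_le_mono) (use j fin card_Suc_Diff1[OF fin j] in linarith)
    qed
    have short: "order_le ?z (\<lambda>n. real (min (pp n i) (n - 1)) * word_kappa_n n R w S)"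
    proof -
      have "order_le (1 - int (card S)) (\<lambda>n. word_kappa_n n R w S)"
        by (rule shorter) (use 4 fin psubset.prems v in auto)
      from order_le_mult[OF order_le_min this] show ?thesis by (rule order_le_mono) simp
    qed
    have eq: "real (n - 1) * word_kappa_n n v w S = real (min (pp n i) (n - 1)) * word_kappa_n n R w S - word_kappa_n n (i # rev R) w S + word_kappa_n n (rev v) w S
      + (\<Sum>t | 0 < t \<and> t < length v \<and> v ! t = i.
          obs_kappa n (\<lambda>\<omega>. tr n (take (Suc t) v) \<omega> * tr n (drop (Suc t) v) \<omega>) w S
        - word_kappa_n n (take (Suc t) v @ rev (drop (Suc t) v)) w S
        - obs_kappa n (\<lambda>\<omega>. tr n (take t v) \<omega> * tr n (drop t v) \<omega>) w S
        + word_kappa_n n (take t v @ rev (drop t v)) w S)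
      + (\<Sum>j\<in>S. \<Sum>t | t < length (w j) \<and> w j ! t = i.
          word_kappa_n n (v @ drop (Suc t) (w j) @ take (Suc t) (w j)) w (S - {j})
        - word_kappa_n n (v @ rev (drop (Suc t) (w j) @ take (Suc t) (w j))) w (S - {j})
        - word_kappa_n n (v @ drop t (w j) @ take t (w j)) w (S - {j})
        + word_kappa_n n (v @ rev (drop t (w j) @ take t (w j))) w (S - {j}))" for n
      using projection_model.word_kappa_recursion[OF projection_model 4(1) fin v, where w = w] unfolding transfer obs_kappa_def .
    have "order_le ?z (\<lambda>n. real (n - 1) * word_kappa_n n v w S)"
      unfolding eq
    proof (intro order_le_add order_le_diff order_le_sum short same prd merge)
      fix t assume "t \<in> {t. 0 < t \<and> t < length v \<and> v ! t = i}"
      then have t: "0 < t" "t < length v" "v ! t = i" by auto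
      have "Suc t \<noteq> length v"
      proof
        assume "Suc t = length v"
        then have "v ! t = last v" using v by (simp add: last_conv_nth)
        then show False using t 4 v by simp
      qed
      then show "drop (Suc t) v \<noteq> []" using t by auto
    qed (use v in auto)
    then have "order_le (1 - int (card S) + int s + 1) (\<lambda>n. real (n - 1) * word_kappa_n n v w S)"
      by (simp add: algebra_simps)
    then show ?thesis by (rule order_le_div)
  qed
qed

lemma word_kappa_n_order:
  assumes "finite S" "v \<noteq> []" "\<forall>j\<in>S. w j \<noteq> []" "total_length v w S \<le> L"
  shows "order_le (1 - int (card S)) (\<lambda>n. word_kappa_n n v w S)"
  using assms
proof (induction L arbitrary: v w S)
  case 0
  then show ?case by auto
next
  case (Suc L)
  \<comment> \<open>Downward induction on s. The a priori exponent is 2 * total + 1 + card S, and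
    card S is at most the total length because words are nonempty. It exceeds 1 - card S by at most
    4 * total, whence the start 4 * Suc L.\<close>
  have boot: "order_le (1 - int (card S) + int s) (\<lambda>n. word_kappa_n n v w S)"
    if "s \<le> 4 * Suc L" "finite S" "v \<noteq> []" "\<forall>j\<in>S. w j \<noteq> []" "total_length v w S \<le> Suc L" for s v w S
    using that
  proof (induction s arbitrary: v w S rule: inc_induct)
    case base
    have card: "card S \<le> (\<Sum>j\<in>S. length (w j))"
      using sum_mono[of S "\<lambda>_. 1" "\<lambda>j. length (w j)"] base by (simp add: Suc_le_eq)
    have "(\<Sum>j\<in>S. 2 * length (w j) + 1) = 2 * (\<Sum>j\<in>S. length (w j)) + card S"
      by (simp only: sum.distrib sum_distrib_left card_eq_sum)
    then have "2 * length v + 1 + (\<Sum>j\<in>S. 2 * length (w j) + 1) + card S \<le> 4 * Suc L + 1"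
      using card base by (cases v) auto
    then show ?case
      by (intro order_le_mono[OF a_priori[OF base(1)]]) linarith
  next
    case (step s)
    show ?case
    proof (rule bootstrap_step[of "Suc L"])
      show "order_le (2 - int (card S) + int s) (\<lambda>n. word_kappa_n n v w S)"
        if "finite S" "v \<noteq> []" "\<forall>j\<in>S. w j \<noteq> []" "total_length v w S \<le> Suc L" for v w S
        using step.IH[OF that] by (simp add: algebra_simps)
    qed (use step.prems Suc.IH in auto)
  qed
  from boot[of 0, OF _ Suc.prems] show ?case by simp
qed

end

subsection \<open>Polynomials\<close>

lemma kappa_cong_family:
  assumes "\<And>j. j \<in> S \<Longrightarrow> T j = T' j"
  shows "kappa M X T S = kappa M X T' S"
proof -
  have "moment M Z T I = moment M Z T' I" if "I \<subseteq> S" for I Z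
  proof -
    have "(\<Prod>j\<in>I. T j \<omega>) = (\<Prod>j\<in>I. T' j \<omega>)" for \<omega>
      using assms that by (intro prod.cong) auto
    then show ?thesis by (simp add: moment_def)
  qed
  then show ?thesis unfolding kappa_def by (intro deconv_cong)
qed

text \<open>Linearity in a slot other than the first: \<open>kappa_insert\<close> moves slot y to
  the front of each term, where \<open>kappa_sum\<close> applies.\<close>

lemma (in prob_space) kappa_sum_family:
  assumes "finite S" "y \<notin> S" and T: "T y = (\<lambda>\<omega>. \<Sum>u\<in>U. c u * Y u \<omega>)"
    and int: "\<And>I u. I \<subseteq> S \<Longrightarrow> u \<in> U \<Longrightarrow> integrable M (\<lambda>\<omega>. X \<omega> * Y u \<omega> * (\<Prod>j\<in>I. T j \<omega>))"
      "\<And>I u. I \<subseteq> S \<Longrightarrow> u \<in> U \<Longrightarrow> integrable M (\<lambda>\<omega>. Y u \<omega> * (\<Prod>j\<in>I. T j \<omega>))"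
  shows "kappa M X T (insert y S) = (\<Sum>u\<in>U. c u * kappa M X (T(y := Y u)) (insert y S))"
proof -
  have T': "kappa M Z (T(y := Y u)) I = kappa M Z T I" if "I \<subseteq> S" for Z I u
    by (rule kappa_cong_family) (use that assms(2) in auto)
  have "kappa M (\<lambda>\<omega>. X \<omega> * T y \<omega>) T S = kappa M (\<lambda>\<omega>. \<Sum>u\<in>U. c u * (X \<omega> * Y u \<omega>)) T S"
    by (simp add: T sum_distrib_left mult_ac)
  also have "\<dots> = (\<Sum>u\<in>U. c u * kappa M (\<lambda>\<omega>. X \<omega> * Y u \<omega>) T S)"
    by (rule kappa_sum) (use assms in auto)
  finally have 1: "kappa M (\<lambda>\<omega>. X \<omega> * T y \<omega>) T S = (\<Sum>u\<in>U. c u * kappa M (\<lambda>\<omega>. X \<omega> * Y u \<omega>) T S)" .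
  have 2: "kappa M (T y) T (S - I) = (\<Sum>u\<in>U. c u * kappa M (Y u) T (S - I))" for I
    unfolding T by (rule kappa_sum) (use assms(1) int(2) in auto)
  have "kappa M X T (insert y S) = (\<Sum>u\<in>U. c u * kappa M (\<lambda>\<omega>. X \<omega> * Y u \<omega>) T S) -
      (\<Sum>I\<in>Pow S. kappa M X T I * (\<Sum>u\<in>U. c u * kappa M (Y u) T (S - I)))"
    unfolding kappa_insert[OF assms(1,2)] 1 2 ..
  also have "(\<Sum>I\<in>Pow S. kappa M X T I * (\<Sum>u\<in>U. c u * kappa M (Y u) T (S - I))) =
      (\<Sum>u\<in>U. c u * (\<Sum>I\<in>Pow S. kappa M X T I * kappa M (Y u) T (S - I)))"
    unfolding sum_distrib_left by (subst sum.swap) (simp only: mult_ac)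
  also have "(\<Sum>u\<in>U. c u * kappa M (\<lambda>\<omega>. X \<omega> * Y u \<omega>) T S) - \<dots> =
      (\<Sum>u\<in>U. c u * (kappa M (\<lambda>\<omega>. X \<omega> * Y u \<omega>) T S - (\<Sum>I\<in>Pow S. kappa M X T I * kappa M (Y u) T (S - I))))"
    by (simp only: right_diff_distrib sum_subtractf)
  also have "\<dots> = (\<Sum>u\<in>U. c u * kappa M X (T(y := Y u)) (insert y S))"
  proof (intro sum.cong refl)
    fix u
    have "(\<Sum>I\<in>Pow S. kappa M X (T(y := Y u)) I * kappa M (Y u) (T(y := Y u)) (S - I)) =
        (\<Sum>I\<in>Pow S. kappa M X T I * kappa M (Y u) T (S - I))"
      by (intro sum.cong refl arg_cong2[where f = "(*)"] T') auto
    then show "c u * (kappa M (\<lambda>\<omega>. X \<omega> * Y u \<omega>) T S - (\<Sum>I\<in>Pow S. kappa M X T I * kappa M (Y u) T (S - I))) =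
        c u * kappa M X (T(y := Y u)) (insert y S)"
      using kappa_insert[OF assms(1,2), of X "T(y := Y u)"] T'[OF subset_refl, of "\<lambda>\<omega>. X \<omega> * Y u \<omega>" u] by simp
  qed
  finally show ?thesis .
qed

lemma mpow_words:
  fixes B :: "nat \<Rightarrow> nat \<Rightarrow> nat \<Rightarrow> real"
  assumes Q: "\<And>a b. a < m \<Longrightarrow> b < m \<Longrightarrow> Q (a,b) = (\<Sum>i\<in>K. B i a b)" and K: "finite K"
  shows "a < m \<Longrightarrow> b < m \<Longrightarrow> mpow m Q d (a,b) = (\<Sum>u | set u \<subseteq> K \<and> length u = d. word_entry m B u a b)"
proof (induction d arbitrary: a)
  case 0
  have "{u. set u \<subseteq> K \<and> length u = 0} = {[]}" by auto
  then show ?case using 0 by (simp add: mpow_def mid_def mk_mat_def)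
next
  case (Suc d)
  let ?L = "\<lambda>d. {u. set u \<subseteq> K \<and> length u = d}"
  have "mpow m Q (Suc d) (a,b) = (\<Sum>c<m. Q (a,c) * mpow m Q d (c,b))"
    using Suc.prems by (simp add: mpow_def mmul_entry)
  also have "\<dots> = (\<Sum>c<m. (\<Sum>i\<in>K. B i a c) * (\<Sum>u\<in>?L d. word_entry m B u c b))"
    using Suc by (simp add: Q)
  also have "\<dots> = (\<Sum>c<m. \<Sum>u\<in>?L d. \<Sum>i\<in>K. B i a c * word_entry m B u c b)"
    unfolding sum_product by (intro sum.cong refl sum.swap)
  also have "\<dots> = (\<Sum>u\<in>?L d. \<Sum>i\<in>K. word_entry m B (i # u) a b)"
    unfolding word_entry_Cons by (subst sum.swap, rule sum.cong[OF refl], rule sum.swap)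
  also have "\<dots> = (\<Sum>(u,i)\<in>?L d \<times> K. word_entry m B (i # u) a b)"
    by (rule sum.cartesian_product)
  also have "\<dots> = (\<Sum>u\<in>(\<lambda>(u,i). i # u) ` (?L d \<times> K). word_entry m B u a b)"
    by (subst sum.reindex) (auto simp: inj_on_def split_def)
  also have "(\<lambda>(u,i). i # u) ` (?L d \<times> K) = ?L (Suc d)"
    by (simp add: lists_length_Suc_eq)
  finally show ?case .
qed

text \<open>The letters do not commute, so a power of Q is the sum of all words of that length, and
  the coefficient of a word depends on its length alone.\<close>

lemma mtr_mpoly_words:
  fixes B :: "nat \<Rightarrow> nat \<Rightarrow> nat \<Rightarrow> real"
  assumes Q: "\<And>a b. a < m \<Longrightarrow> b < m \<Longrightarrow> Q (a,b) = (\<Sum>i\<in>K. B i a b)" and K: "finite K"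
  shows "mtr m (mpoly m q Q) = (\<Sum>u | set u \<subseteq> K \<and> length u \<le> degree q. coeff q (length u) * word_trace m B u)"
proof -
  have "mtr m (mpoly m q Q) = (\<Sum>a<m. \<Sum>d\<le>degree q. coeff q d * (\<Sum>u | set u \<subseteq> K \<and> length u = d. word_entry m B u a a))"
    unfolding mtr_def mpoly_def by (intro sum.cong refl) (simp add: mk_mat_def mpow_words[where Q = Q and K = K and B = B, OF Q K])
  also have "\<dots> = (\<Sum>d\<le>degree q. \<Sum>a<m. coeff q d * (\<Sum>u | set u \<subseteq> K \<and> length u = d. word_entry m B u a a))"
    by (rule sum.swap)
  also have "\<dots> = (\<Sum>d\<le>degree q. \<Sum>u | set u \<subseteq> K \<and> length u = d. coeff q (length u) * word_trace m B u)"
  proof (intro sum.cong refl)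
    fix d
    have "(\<Sum>a<m. coeff q d * (\<Sum>u | set u \<subseteq> K \<and> length u = d. word_entry m B u a a)) =
      (\<Sum>u | set u \<subseteq> K \<and> length u = d. coeff q d * word_trace m B u)"
      unfolding word_trace_def sum_distrib_left by (rule sum.swap)
    then show "(\<Sum>a<m. coeff q d * (\<Sum>u | set u \<subseteq> K \<and> length u = d. word_entry m B u a a)) =
      (\<Sum>u | set u \<subseteq> K \<and> length u = d. coeff q (length u) * word_trace m B u)" by simp
  qed
  also have "\<dots> = (\<Sum>d\<le>degree q. \<Sum>u\<in>{u\<in>{u. set u \<subseteq> K \<and> length u \<le> degree q}. length u = d}. coeff q (length u) * word_trace m B u)"
    by (intro sum.cong) auto
  also have "\<dots> = (\<Sum>u | set u \<subseteq> K \<and> length u \<le> degree q. coeff q (length u) * word_trace m B u)"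
    by (rule sum.group) (auto intro: finite_lists_length_le[OF K])
  finally show ?thesis .
qed

lemma Qmat_entry:
  assumes "a < m" "b < m"
  shows "Qmat m k p \<omega> (a,b) = (\<Sum>i\<in>{1..k}. proj_mat m (\<lambda>l. if l \<in> {1..k} then p l else 0) \<omega> i a b)"
proof -
  have "mmul m (mT m (\<omega> i)) (mproj m (p i)) (a,c) = of_bool (c < p i) * \<omega> i (c,a)" if "c < m" for c i
  proof -
    have "mproj m (p i) (d,c) = of_bool (d = c) * of_bool (d < p i)" if "d < m" for d
      using that \<open>c < m\<close> by (simp add: mproj_def mk_mat_def)
    then have "mmul m (mT m (\<omega> i)) (mproj m (p i)) (a,c) = (\<Sum>d<m. of_bool (d = c) * (of_bool (d < p i) * \<omega> i (d,a)))"
      unfolding mmul_entry[OF assms(1) that] using assms by (intro sum.cong refl) (simp add: mT_entry)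
    then show ?thesis using that by (simp only: sum_of_bool)
  qed
  then show ?thesis
    using assms by (simp add: Qmat_def msum_def mk_mat_def[of m] mmul_entry proj_mat_def mult.assoc)
qed

section \<open>From traces of words to traces of polynomials\<close>

context haar_family begin

lemma prob_space_OM: "prob_space (OM n)"
  unfolding OM_def
  by (rule prob_space_PiM) (use haar.haar[OF projection_model.axioms(1)[OF projection_model[of n]]] in \<open>simp add: haar_orth_def\<close>)

text \<open>Constant terms of polynomials bring in the empty word, whose trace is the constant m:
  alone it has order 1, and any joint cumulant containing it vanishes.\<close>

lemma word_kappa_n_order_all:
  assumes "finite S"
  shows "order_le (1 - int (card S)) (\<lambda>n. word_kappa_n n v w S)"
proof -
  interpret P: prob_space "OM n" for n by (rule prob_space_OM)
  have Nil: "tr n [] = (\<lambda>_. real (n - 1))" for n by (simp add: tr_def fun_eq_iff)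
  consider y where "y \<in> S" "w y = []" | "v = []" "S = {}" | "v = []" "S \<noteq> {}" | "v \<noteq> []" "\<forall>j\<in>S. w j \<noteq> []" by blast
  then show ?thesis
  proof cases
    case 1
    then have "word_kappa_n n v w S = 0" for n
      using P.kappa_insert_const[where S = "S - {y}" and y = y and T = "\<lambda>j. tr n (w j)" and c = "real (n - 1)" and X = "tr n v"] assms
      by (simp add: obs_kappa_def Nil insert_absorb)
    then show ?thesis by (simp add: order_le_def)
  next
    case 2
    then show ?thesis by (simp add: obs_kappa_def Nil P.kappa_const order_le_bound[of _ 1])
  next
    case 3
    then show ?thesis using assms by (simp add: obs_kappa_def Nil P.kappa_const order_le_def)
  next
    case 4
    then show ?thesis using word_kappa_n_order[OF assms] by blast
  qed
qed

lemma bounded_obs_tr: "tr n u \<in> projection_model.bounded_obs (n - 1) (H n) k"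
  using projection_model.bounded_obs_trace_word[OF projection_model, unfolded transfer] .

lemma integrable_tr_prod:
  assumes "X \<in> projection_model.bounded_obs (n - 1) (H n) k" "\<And>j. j \<in> I \<Longrightarrow> T j \<in> projection_model.bounded_obs (n - 1) (H n) k"
  shows "integrable (OM n) (\<lambda>\<omega>. X \<omega> * (\<Prod>j\<in>I. T j \<omega>))"
proof -
  have "(\<lambda>\<omega>. X \<omega> * (\<Prod>j\<in>I. T j \<omega>)) \<in> projection_model.bounded_obs (n - 1) (H n) k"
    by (intro projection_model.bounded_obs_mult[OF projection_model] projection_model.bounded_obs_prod[OF projection_model] assms)
  from projection_model.bounded_obs_integrable[OF projection_model this] show ?thesis by (simp only: transfer)
qed

definition word_poly :: "nat \<Rightarrow> nat list set \<Rightarrow> (nat list \<Rightarrow> real) \<Rightarrow> (nat \<Rightarrow> nat \<times> nat \<Rightarrow> real) \<Rightarrow> real" where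
  "word_poly n U c \<omega> = (\<Sum>u\<in>U. c u * tr n u \<omega>)"

text \<open>Multilinear expansion, one slot at a time; J collects the slots that hold polynomials.
  The words \<open>w\<close> vary in the induction because every summand puts its own word into slot
  y.\<close>

lemma word_poly_kappa_order:
  fixes w :: "nat \<Rightarrow> nat list"
  assumes "finite J" "finite S" "J \<subseteq> S" 
  shows "order_le (1 - int (card S)) (\<lambda>n. kappa (OM n) (word_poly n V d) (\<lambda>j. if j \<in> J then word_poly n (U j) (c j) else tr n (w j)) S)"
  using assms
proof (induction J arbitrary: w rule: finite_induct)
  case empty
  interpret P: prob_space "OM n" for n by (rule prob_space_OM)
  have "kappa (OM n) (word_poly n V d) (\<lambda>j. tr n (w j)) S = (\<Sum>u\<in>V. d u * word_kappa_n n u w S)" for n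
    unfolding word_poly_def[abs_def] obs_kappa_def
    by (rule P.kappa_sum) (use empty in \<open>auto intro!: integrable_tr_prod bounded_obs_tr\<close>)
  moreover have "order_le (1 - int (card S)) (\<lambda>n. d u * word_kappa_n n u w S)" for u
    using word_kappa_n_order_all[OF empty(1), of u w] by (auto simp: order_le_def)
  ultimately show ?case by (simp add: order_le_sum)
next
  case (insert y J)
  interpret P: prob_space "OM n" for n by (rule prob_space_OM)
  let ?T = "\<lambda>n j. if j \<in> insert y J then word_poly n (U j) (c j) else tr n (w j)"
  have word_poly: "word_poly n U' c' \<in> projection_model.bounded_obs (n - 1) (H n) k" for n U' c'
    unfolding word_poly_def[abs_def] by (intro projection_model.bounded_obs_sum[OF projection_model] projection_model.bounded_obs_mult[OF projection_model] projection_model.bounded_obs_const[OF projection_model] bounded_obs_tr)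
  have T: "?T n j \<in> projection_model.bounded_obs (n - 1) (H n) k" for n j using bounded_obs_tr word_poly by auto
  define S0 where "S0 = S - {y}"
  have S0: "S = insert y S0" "y \<notin> S0" "finite S0" using insert.prems by (auto simp: S0_def)
  have "kappa (OM n) (word_poly n V d) (?T n) S = (\<Sum>u\<in>U y. c y u * kappa (OM n) (word_poly n V d) ((?T n)(y := tr n u)) S)" for n
    unfolding S0(1)
  proof (rule P.kappa_sum_family[OF S0(3,2)])
    show "?T n y = (\<lambda>\<omega>. \<Sum>u\<in>U y. c y u * tr n u \<omega>)" by (simp add: word_poly_def fun_eq_iff)
    fix I u
    show "integrable (OM n) (\<lambda>\<omega>. word_poly n V d \<omega> * tr n u \<omega> * (\<Prod>j\<in>I. ?T n j \<omega>))"
      by (rule integrable_tr_prod[OF projection_model.bounded_obs_mult[OF projection_model word_poly bounded_obs_tr] T])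
    show "integrable (OM n) (\<lambda>\<omega>. tr n u \<omega> * (\<Prod>j\<in>I. ?T n j \<omega>))"
      by (rule integrable_tr_prod[OF bounded_obs_tr T])
  qed
  moreover have "(?T n)(y := tr n u) = (\<lambda>j. if j \<in> J then word_poly n (U j) (c j) else tr n ((w(y := u)) j))" for n u
    using insert.hyps by (auto simp: fun_eq_iff)
  moreover have "order_le (1 - int (card S)) (\<lambda>n. c y u * kappa (OM n) (word_poly n V d)
      (\<lambda>j. if j \<in> J then word_poly n (U j) (c j) else tr n ((w(y := u)) j)) S)" for u
    using insert.IH[of "w(y := u)"] insert.prems by (auto simp: order_le_def)
  ultimately show ?case by (simp only: order_le_sum)
qed

end

theorem theorem2:
  fixes k :: nat and p :: "nat \<Rightarrow> nat \<Rightarrow> nat" and y :: "nat \<Rightarrow> real"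
    and H :: "nat \<Rightarrow> (nat \<times> nat \<Rightarrow> real) measure" and h :: "nat \<Rightarrow> real poly"
  assumes "k \<ge> 2"
    and "\<forall>i\<in>{1..k}. \<forall>n. p i n > 0"
    and "\<forall>i\<in>{1..k}. 0 < y i \<and> y i < 1"
    and "\<forall>i\<in>{1..k}. (\<lambda>n. real (p i n) / real n) \<longlonglongrightarrow> y i"
    and "\<forall>n. haar_orth (n - 1) (H n)"
  defines "\<Omega> \<equiv> \<lambda>n. PiM {1..k} (\<lambda>_. H n)"
    and "T \<equiv> \<lambda>n j \<omega>. mtr (n - 1) (mpoly (n - 1) (h j) (Qmat (n - 1) k (\<lambda>i. p i n) \<omega>))"
  shows "(\<lambda>n. covariance (\<Omega> n) (T n 1) (T n 2)) \<in> O(\<lambda>_. 1) \<and>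
      (\<forall>r\<ge>3. (\<lambda>n. cumulant (\<Omega> n) (T n) r) \<longlonglongrightarrow> 0)"
proof -
  \<comment> \<open>Ranks are padded by 0 outside {1..k}, as \<open>projection_model\<close>
    demands; \<open>Qmat\<close> only involves indices in {1..k}.\<close>
  define pp where "pp n l = (if l \<in> {1..k} then p l n else 0)" for n l
  interpret haar_family k pp H
    by standard (use assms(5) in \<open>auto simp: pp_def haar_orth_def\<close>)
  interpret P: prob_space "OM n" for n by (rule prob_space_OM)
  have \<Omega>: "\<Omega> n = OM n" for n by (simp add: \<Omega>_def OM_def)
  define U where "U j = {u. set u \<subseteq> {1..k} \<and> length u \<le> degree (h j)}" for j
  define c where "c j u = coeff (h j) (length u)" for j and u :: "nat list"
  have T: "T n j = word_poly n (U j) (c j)" for n j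
  proof
    fix \<omega>
    have "Qmat (n - 1) k (\<lambda>i. p i n) \<omega> (a,b) = (\<Sum>i\<in>{1..k}. proj_mat (n - 1) (pp n) \<omega> i a b)"
      if "a < n - 1" "b < n - 1" for a b
      using Qmat_entry[OF that, of k "\<lambda>i. p i n" \<omega>] unfolding pp_def[abs_def] .
    then show "T n j \<omega> = word_poly n (U j) (c j) \<omega>"
      unfolding T_def word_poly_def U_def c_def tr_def by (intro mtr_mpoly_words) auto
  qed
  \<comment> \<open>The covariance is the case S = {2}, of order 0; the r-th cumulant is the case S
    = {2..r}, of order 2 - r, which is at most -1 for r \<ge> 3.\<close>
  have order: "order_le (1 - int (card S)) (\<lambda>n. kappa (\<Omega> n) (T n 1) (T n) S)" if "finite S" for S
  proof -
    have "kappa (OM n) (word_poly n (U 1) (c 1)) (\<lambda>j. if j \<in> S then word_poly n (U j) (c j) else tr n []) S =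
        kappa (OM n) (word_poly n (U 1) (c 1)) (\<lambda>j. word_poly n (U j) (c j)) S" for n
      by (rule kappa_cong_family) simp
    then show ?thesis
      using word_poly_kappa_order[OF that that subset_refl, of "U 1" "c 1" U c "\<lambda>_. []"] unfolding \<Omega> T by simp
  qed
  have "order_le 0 (\<lambda>n. covariance (\<Omega> n) (T n 1) (T n 2))"
    unfolding \<Omega> P.covariance_eq_kappa using order[of "{2}"] by (simp add: \<Omega>)
  moreover have "(\<lambda>n. cumulant (\<Omega> n) (T n) r) \<longlonglongrightarrow> 0" if "r \<ge> 3" for r
  proof -
    have "order_le (-1) (\<lambda>n. cumulant (\<Omega> n) (T n) r)"
      using order_le_mono[OF order[of "{2..r}"], of "-1"] that by (simp add: \<Omega> P.cumulant_eq_kappa of_nat_diff)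
    then obtain C where C: "eventually (\<lambda>n. norm (cumulant (\<Omega> n) (T n) r) \<le> C * norm (real (n - 1) powi (-1))) sequentially"
      unfolding order_le_def by (auto elim: landau_o.bigE)
    have "(\<lambda>n. C * norm (real (n - 1) powi (-1))) \<longlonglongrightarrow> C * 0"
    proof (intro tendsto_mult_left)
      have "(\<lambda>n. inverse (real n)) \<longlonglongrightarrow> 0" by (rule lim_inverse_n)
      then have "(\<lambda>n. inverse (real (Suc n - 1))) \<longlonglongrightarrow> 0" by simp
      then have "(\<lambda>n. inverse (real (n - 1))) \<longlonglongrightarrow> 0" by (subst (asm) filterlim_sequentially_Suc)
      then show "(\<lambda>n. norm (real (n - 1) powi (-1))) \<longlonglongrightarrow> 0"
        by (simp add: power_int_minus)
    qed
    then show ?thesis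
      using C by (intro Lim_null_comparison[OF C]) simp
  qed
  ultimately show ?thesis by (simp add: order_le_def)
qed

end
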